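(* Let $G$ be a connected bipartite graph with maximum degree $\Delta\geqslant 3$. Then $R(G)\leqslant\sqrt{\Delta-2}$, unless $G$ is the incidence graph of a projective plane of order $\Delta-1$, in which case $R(G)=\sqrt{\Delta-1}$.
   Context: All graphs are simple. For a graph $G$ of order $n$ with adjacency eigenvalues $\lambda_1\geqslant\cdots\geqslant\lambda_n$, the HL-index is $R(G)=\max\{|\lambda_{\lfloor (n+1)/2\rfloor}|,\ |\lambda_{\lceil (n+1)/2\rceil}|\}$. The incidence graph of a projective plane is the bipartite graph whose two parts are the points and the lines of the plane, a point being adjacent to a line iff it lies on it. *)

theory Defs
  imports "Jordan_Normal_Form.Char_Poly" "HOL-Computational_Algebra.Polynomial"
    "HOL-Library.Multiset"
begin

definition simple_graph :: "nat \<Rightarrow> (nat \<Rightarrow> nat \<Rightarrow> bool) \<Rightarrow> bool" where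
  "simple_graph n E \<longleftrightarrow> (\<forall>u<n. \<forall>v<n. E u v \<longleftrightarrow> E v u) \<and> (\<forall>u<n. \<not> E u u)"

definition connected_graph :: "nat \<Rightarrow> (nat \<Rightarrow> nat \<Rightarrow> bool) \<Rightarrow> bool" where
  "connected_graph n E \<longleftrightarrow> n > 0 \<and>
     (\<forall>u<n. \<forall>v<n. (\<lambda>x y. x < n \<and> y < n \<and> E x y)\<^sup>*\<^sup>* u v)"

definition bipartite_graph :: "nat \<Rightarrow> (nat \<Rightarrow> nat \<Rightarrow> bool) \<Rightarrow> bool" where
  "bipartite_graph n E \<longleftrightarrow> (\<exists>c :: nat \<Rightarrow> bool. \<forall>u<n. \<forall>v<n. E u v \<longrightarrow> c u \<noteq> c v)"

definition degree :: "nat \<Rightarrow> (nat \<Rightarrow> nat \<Rightarrow> bool) \<Rightarrow> nat \<Rightarrow> nat" where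
  "degree n E u = card {v. v < n \<and> E u v}"

definition max_degree :: "nat \<Rightarrow> (nat \<Rightarrow> nat \<Rightarrow> bool) \<Rightarrow> nat" where
  "max_degree n E = Max (degree n E ` {0..<n})"

definition adj_matrix :: "nat \<Rightarrow> (nat \<Rightarrow> nat \<Rightarrow> bool) \<Rightarrow> real mat" where
  "adj_matrix n E = mat n n (\<lambda>(i, j). if E i j then 1 else 0)"

text \<open>Adjacency eigenvalues (with multiplicity) in non-increasing order:
  eig n E k = \<lambda>_k for 1 \<le> k \<le> n.\<close>

definition eig :: "nat \<Rightarrow> (nat \<Rightarrow> nat \<Rightarrow> bool) \<Rightarrow> nat \<Rightarrow> real" where
  "eig n E k = rev (sorted_list_of_multiset (proots (char_poly (adj_matrix n E)))) ! (k - 1)"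

definition HL_index :: "nat \<Rightarrow> (nat \<Rightarrow> nat \<Rightarrow> bool) \<Rightarrow> real" where
  "HL_index n E = max \<bar>eig n E ((n + 1) div 2)\<bar> \<bar>eig n E ((n + 2) div 2)\<bar>"

definition projective_plane_of_order ::
  "nat set \<Rightarrow> nat set \<Rightarrow> (nat \<Rightarrow> nat \<Rightarrow> bool) \<Rightarrow> nat \<Rightarrow> bool" where
  "projective_plane_of_order P L I q \<longleftrightarrow>
     (\<forall>p\<in>P. \<forall>p'\<in>P. p \<noteq> p' \<longrightarrow> (\<exists>!l. l \<in> L \<and> I p l \<and> I p' l)) \<and>
     (\<forall>l\<in>L. \<forall>l'\<in>L. l \<noteq> l' \<longrightarrow> (\<exists>!p. p \<in> P \<and> I p l \<and> I p l')) \<and>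
     (\<exists>F \<subseteq> P. card F = 4 \<and>
        (\<forall>l\<in>L. card {p \<in> F. I p l} \<le> 2)) \<and>
     (\<forall>l\<in>L. card {p \<in> P. I p l} = q + 1)"

text \<open>The graph is (isomorphic to, i.e. literally is up to vertex naming) the incidence graph
  of a projective plane of order q: its vertex set splits into points P and lines L, every
  edge joins a point and a line, and adjacency is incidence.\<close>

definition is_PP_incidence_graph :: "nat \<Rightarrow> (nat \<Rightarrow> nat \<Rightarrow> bool) \<Rightarrow> nat \<Rightarrow> bool" where
  "is_PP_incidence_graph n E q \<longleftrightarrow>
     (\<exists>P L. P \<union> L = {0..<n} \<and> P \<inter> L = {} \<and>
        (\<forall>u<n. \<forall>v<n. E u v \<longrightarrow> (u \<in> P \<and> v \<in> L) \<or> (u \<in> L \<and> v \<in> P)) \<and>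
        projective_plane_of_order P L E q)"

end

theory Submission
  imports Defs "HOL-Analysis.Function_Topology" "HOL-Library.Function_Algebras"
begin

text \<open>Let \<open>D\<close> be the maximum degree. The spectrum is symmetric, so if \<open>R(G)\<close> exceeds
  \<open>\<surd>(D - 2)\<close> then every eigenvalue does so in absolute value and \<open>A\<^sup>2 - (D - 2)\<close> is positive
  definite. On the integer vectors supported on one colour class (the ``points''; the other class
  are the ``lines'') this is an integral form in which a vertex has norm \<open>deg - D + 2\<close> and two
  points have as product the number of their common neighbours. Short vectors show that two points
  lie on at most one line, that degrees are \<open>D - 1\<close> or \<open>D\<close>, and finally that all degrees are \<open>D\<close>.

  Now all points have norm 2, and the point vectors are a basis of a root lattice in which each
  of them has the same product \<open>K = D\<^sup>2 - D + 2\<close> with their sum \<open>S\<close>. Let the height of a vector be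
  its coefficient sum, which is \<open>K\<^sup>-\<^sup>1\<close> times its product with \<open>S\<close>. A root of height at least 2 has
  product 1 with at least \<open>2 K\<close> points, which contradicts definiteness; so all heights are at
  most 1. The roots of height 1 are permuted by the reflections in the differences of collinear points,
  which makes their first moment a multiple of \<open>S\<close> and, since there are at least three lines through
  a point, determines their second moment form on height 0 up to a scalar. Comparing traces leaves
  \<open>k (K (K - 3) - (K - 4) m) = 2 (m - 1)\<close> for the number \<open>m\<close> of points and an integer \<open>k \<ge> 0\<close>, hence
  \<open>m \<le> K + 1\<close>, and all points are pairwise collinear. By duality, so are the lines.\<close>

section \<open>Spectra of symmetric and bipartite adjacency matrices\<close>

text \<open>The characteristic polynomial splits over the complex numbers. For a root
  \<open>c\<close> with eigenvector \<open>v\<close>, symmetry makes the Hermitian form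
  \<open>Q\<close> its own conjugate, and \<open>Q\<close> is \<open>c\<close> times a positive
  real. So all roots are real and the factorization descends.\<close>

lemma real_symmetric_char_poly:
  fixes a :: "nat \<Rightarrow> nat \<Rightarrow> real"
  assumes sym: "\<And>i j. a i j = a j i"
  obtains bs where "length bs = n" "char_poly (mat n n (\<lambda>(i, j). a i j)) = (\<Prod>b\<leftarrow>bs. [:- b, 1:])"
proof -
  define A where "A = mat n n (\<lambda>(i, j). a i j)"
  define C where "C = map_mat complex_of_real A"
  have A: "A \<in> carrier_mat n n" and C: "C \<in> carrier_mat n n" by (auto simp: A_def C_def)
  obtain cs where cs: "char_poly C = (\<Prod>c\<leftarrow>cs. [:- c, 1:])" "length cs = n"
    using char_poly_factorized[OF C] by auto
  have real: "c = complex_of_real (Re c)" if "c \<in> set cs" for c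
  proof -
    have "poly (char_poly C) c = 0"
      using that by (auto simp: cs poly_prod_list prod_list_zero_iff)
    then have "eigenvalue C c" using eigenvalue_root_char_poly[OF C] by simp
    then obtain v where v: "v \<in> carrier_vec n" "v \<noteq> 0\<^sub>v n" "C *\<^sub>v v = c \<cdot>\<^sub>v v"
      using C by (auto simp: eigenvalue_def eigenvector_def)
    have Cv: "(\<Sum>j<n. complex_of_real (a i j) * v $ j) = c * v $ i" if "i < n" for i
    proof -
      have "(C *\<^sub>v v) $ i = (\<Sum>j<n. complex_of_real (a i j) * v $ j)"
        using that v(1) by (auto simp: C_def A_def scalar_prod_def lessThan_atLeast0 intro!: sum.cong)
      then show ?thesis using v that by simp
    qed
    define Q where "Q = (\<Sum>i<n. cnj (v $ i) * (\<Sum>j<n. complex_of_real (a i j) * v $ j))"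
    have "cnj Q = (\<Sum>i<n. \<Sum>j<n. v $ i * (complex_of_real (a i j) * cnj (v $ j)))"
      by (simp add: Q_def sum_distrib_left)
    also have "\<dots> = (\<Sum>j<n. \<Sum>i<n. v $ i * (complex_of_real (a i j) * cnj (v $ j)))"
      by (rule sum.swap)
    also have "\<dots> = Q"
      unfolding Q_def sum_distrib_left by (intro sum.cong refl) (simp add: sym mult_ac)
    finally have "Im Q = 0" by (metis complex_cnj add.inverse_neutral cnj.simps(2) neg_equal_zero)
    have "Q = (\<Sum>i<n. c * complex_of_real ((cmod (v $ i))\<^sup>2))"
      unfolding Q_def
    proof (intro sum.cong refl)
      fix i assume "i \<in> {..<n}"
      then show "cnj (v $ i) * (\<Sum>j<n. complex_of_real (a i j) * v $ j)
          = c * complex_of_real ((cmod (v $ i))\<^sup>2)"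
        by (subst Cv) (auto simp: complex_norm_square simp del: of_real_power)
    qed
    then have Q: "Q = c * complex_of_real (\<Sum>i<n. (cmod (v $ i))\<^sup>2)"
      by (simp add: sum_distrib_left)
    have "\<exists>i<n. v $ i \<noteq> 0"
      using v(1,2) by (auto simp: vec_eq_iff)
    then have "(\<Sum>i<n. (cmod (v $ i))\<^sup>2) \<noteq> 0"
      by (auto simp: sum_nonneg_eq_0_iff)
    moreover have "Im c * (\<Sum>i<n. (cmod (v $ i))\<^sup>2) = 0"
      using \<open>Im Q = 0\<close> unfolding Q by simp
    ultimately have "Im c = 0" by simp
    then show ?thesis by (simp add: complex_eq_iff)
  qed
  define bs where "bs = map Re cs"
  have "poly (char_poly A) x = poly (\<Prod>b\<leftarrow>bs. [:- b, 1:]) x" for x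
  proof -
    have "complex_of_real (poly (char_poly A) x) = poly (char_poly C) (complex_of_real x)"
      unfolding C_def of_real_hom.char_poly_hom[OF A] by simp
    also have "\<dots> = (\<Prod>c\<leftarrow>cs. complex_of_real x - c)"
      by (simp add: cs poly_prod_list o_def)
    also have "\<dots> = (\<Prod>c\<leftarrow>cs. complex_of_real (x - Re c))"
      using real by (intro arg_cong[of _ _ prod_list] map_cong) auto
    also have "\<dots> = complex_of_real (\<Prod>c\<leftarrow>cs. x - Re c)"
      by (induction cs) auto
    finally have "poly (char_poly A) x = (\<Prod>c\<leftarrow>cs. x - Re c)" by (simp only: of_real_eq_iff)
    then show ?thesis by (simp add: bs_def poly_prod_list o_def)
  qed
  then have "char_poly A = (\<Prod>b\<leftarrow>bs. [:- b, 1:])"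
    by (simp add: poly_eq_poly_eq_iff[symmetric] fun_eq_iff)
  moreover have "length bs = n" by (simp add: bs_def cs)
  ultimately show ?thesis using that A_def by blast
qed

lemma proots_linear_factors: "proots (\<Prod>b\<leftarrow>bs. [:- b, 1:]) = mset (bs :: real list)"
proof (induction bs)
  case (Cons b bs)
  have "(\<Prod>b\<leftarrow>bs. [:- b, 1:]) \<noteq> 0" by (auto simp: prod_list_zero_iff)
  then have "proots ([:- b, 1:] * (\<Prod>b\<leftarrow>bs. [:- b, 1:])) = proots [:- b, 1:] + mset bs"
    by (subst proots_mult) (use Cons in auto)
  then show ?case by (simp only: list.map prod_list.Cons proots_linear_factor) simp
qed simp

text \<open>Turns eigenvectors into plain functions, so that later computations are finite sums free
  of matrix dimensions.\<close>

lemma eigenvalue_sum_iff: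
  fixes a :: "nat \<Rightarrow> nat \<Rightarrow> real"
  shows "eigenvalue (mat n n (\<lambda>(i, j). a i j)) \<mu> \<longleftrightarrow>
    (\<exists>x. (\<exists>i<n. x i \<noteq> 0) \<and> (\<forall>i<n. (\<Sum>j<n. a i j * x j) = \<mu> * x i))"
proof -
  let ?A = "mat n n (\<lambda>(i, j). a i j)"
  have mv: "(?A *\<^sub>v v) $ i = (\<Sum>j<n. a i j * v $ j)" if "i < n" "v \<in> carrier_vec n" for i v
    using that by (auto simp: scalar_prod_def lessThan_atLeast0 intro!: sum.cong)
  show ?thesis
  proof
    assume "eigenvalue ?A \<mu>"
    then obtain v where v: "v \<in> carrier_vec n" "v \<noteq> 0\<^sub>v n" "?A *\<^sub>v v = \<mu> \<cdot>\<^sub>v v"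
      by (auto simp: eigenvalue_def eigenvector_def)
    have "\<exists>i<n. v $ i \<noteq> 0" using v(1,2) by (auto simp: vec_eq_iff)
    moreover have "(\<Sum>j<n. a i j * v $ j) = \<mu> * v $ i" if "i < n" for i
      using mv[OF that v(1)] v that by simp
    ultimately show "\<exists>x. (\<exists>i<n. x i \<noteq> 0) \<and> (\<forall>i<n. (\<Sum>j<n. a i j * x j) = \<mu> * x i)" by blast
  next
    assume "\<exists>x. (\<exists>i<n. x i \<noteq> 0) \<and> (\<forall>i<n. (\<Sum>j<n. a i j * x j) = \<mu> * x i)"
    then obtain x where x: "\<exists>i<n. x i \<noteq> 0" "\<And>i. i < n \<Longrightarrow> (\<Sum>j<n. a i j * x j) = \<mu> * x i" by blast
    have "eigenvector ?A (vec n x) \<mu>"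
      unfolding eigenvector_def using x
      by (auto simp: vec_eq_iff mv simp del: index_mult_mat_vec)
    then show "eigenvalue ?A \<mu>" by (auto simp: eigenvalue_def)
  qed
qed

text \<open>First-order condition for the minimum at \<open>t = 0\<close>. The choice of
  \<open>s\<close> ensures \<open>c * s \<le> 1\<close>, so for \<open>b \<noteq> 0\<close> the
  value at \<open>- b * s\<close> would be at most - s b^2 < 0.\<close>

lemma quadratic_nonneg_imp_linear_zero:
  fixes b c :: real
  assumes "\<And>t. 0 \<le> c * t\<^sup>2 + 2 * b * t"
  shows "b = 0"
proof (rule ccontr)
  assume "b \<noteq> 0"
  define s where "s = 1 / (\<bar>c\<bar> + 1)"
  have s: "0 < s" "(\<bar>c\<bar> + 1) * s = 1" by (auto simp: s_def)
  have "c * s \<le> \<bar>c\<bar> * s" using s by (intro mult_right_mono) auto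
  moreover have "\<bar>c\<bar> * s + s = 1" using s(2) by (simp add: algebra_simps)
  ultimately have "c * s \<le> 1" using s(1) by linarith
  then have "s * (c * s - 2) < 0" using s(1) by (intro mult_pos_neg) auto
  then have "b\<^sup>2 * (s * (c * s - 2)) < 0" using \<open>b \<noteq> 0\<close> by (intro mult_pos_neg[of "b\<^sup>2"]) auto
  moreover have "c * (- b * s)\<^sup>2 + 2 * b * (- b * s) = b\<^sup>2 * (s * (c * s - 2))"
    by (simp add: power2_eq_square algebra_simps)
  ultimately show False using assms[of "- b * s"] by linarith
qed

text \<open>The minimum of the Rayleigh quotient of the squared matrix is attained by compactness, and
  it is the square of an eigenvalue.\<close>

lemma symmetric_square_coercive:
  fixes a :: "nat \<Rightarrow> nat \<Rightarrow> real"
  assumes sym: "\<And>i j. a i j = a j i" and c: "0 \<le> c" and n: "0 < n"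
    and big: "\<And>\<mu>. eigenvalue (mat n n (\<lambda>(i, j). a i j)) \<mu> \<Longrightarrow> c < \<bar>\<mu>\<bar>"
  obtains m where "c\<^sup>2 < m" "\<And>x. m * (\<Sum>i<n. (x i)\<^sup>2) \<le> (\<Sum>i<n. (\<Sum>j<n. a i j * x j)\<^sup>2)"
proof -
  define Ax where "Ax = (\<lambda>x i. \<Sum>j<n. a i j * x j)"
  have Ax_apply: "Ax x i = (\<Sum>j<n. a i j * x j)" for x i by (simp add: Ax_def)
  define q where "q = (\<lambda>x. \<Sum>i<n. (Ax x i)\<^sup>2)"
  define r where "r = (\<lambda>x :: nat \<Rightarrow> real. \<Sum>i<n. (x i)\<^sup>2)"
  define S where "S = {x. (\<forall>i. i \<notin> {..<n} \<longrightarrow> x i = 0) \<and> r x = 1}"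
  have coord: "continuous_on UNIV (\<lambda>x :: nat \<Rightarrow> real. x i)" for i by simp
  have contr: "continuous_on UNIV r" unfolding r_def by (intro continuous_intros coord)
  have contq: "continuous_on UNIV q" unfolding q_def Ax_def by (intro continuous_intros coord)
  have "compact S"
  proof -
    \<comment> \<open>All but the first \<open>n\<close> coordinates are pinned to 0, so
      \<open>S\<close> lies in a product of compact sets and Tychonoff's theorem applies in the
      function space.\<close>
    define B where "B = PiE UNIV (\<lambda>i. if i \<in> {..<n} then {-1..1::real} else {0})"
    have "compactin (product_topology (\<lambda>i. euclidean) UNIV) B"
      unfolding B_def by (subst compactin_PiE) auto
    then have "compact B" by (simp add: euclidean_product_topology)
    moreover have "closed S"
      unfolding S_def using contr
      by (intro closed_Collect_conj closed_Collect_all closed_Collect_imp closed_Collect_eq)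
        (auto intro!: continuous_intros)
    moreover have "S \<subseteq> B"
    proof
      fix x assume x: "x \<in> S"
      have "(x i)\<^sup>2 \<le> 1" if "i < n" for i
      proof -
        have "(x i)\<^sup>2 \<le> r x" unfolding r_def using that by (intro member_le_sum) auto
        then show ?thesis using x by (simp add: S_def)
      qed
      then have "\<bar>x i\<bar> \<le> 1" if "i < n" for i using that by (simp add: abs_square_le_1)
      then show "x \<in> B" using x by (auto simp: B_def S_def abs_le_iff)
    qed
    ultimately show ?thesis by (metis compact_Int_closed inf.absorb_iff2)
  qed
  moreover have "(\<lambda>i. if i = 0 then 1 else 0) \<in> S"
    using n by (auto simp: S_def r_def if_distrib[of "\<lambda>a. a\<^sup>2"] cong: if_cong)
  ultimately obtain x0 where x0: "x0 \<in> S" "\<And>y. y \<in> S \<Longrightarrow> q x0 \<le> q y"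
    using continuous_attains_inf[of S q] contq continuous_on_subset by (metis empty_iff subset_UNIV)
  define m where "m = q x0"
  have r0: "0 \<le> r x" for x by (simp add: r_def sum_nonneg)
  have min: "m * r x \<le> q x" for x
  proof (cases "r x = 0")
    case True
    then show ?thesis by (simp add: q_def sum_nonneg)
  next
    case False
    define t where "t = sqrt (r x)"
    have t: "0 < t" "t\<^sup>2 = r x" using False r0[of x] by (auto simp: t_def)
    define y where "y = (\<lambda>i. if i < n then x i / t else 0)"
    have ry: "r y = r x / t\<^sup>2"
      unfolding r_def y_def sum_divide_distrib by (intro sum.cong) (auto simp: power_divide)
    have "Ax y i = Ax x i / t" for i
      unfolding Ax_def y_def sum_divide_distrib by (intro sum.cong) auto
    then have qy: "q y = q x / t\<^sup>2"
      unfolding q_def sum_divide_distrib by (simp add: power_divide)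
    have "y \<in> S" using ry t False by (auto simp: S_def y_def)
    then have "m \<le> q y" using x0 by (simp add: m_def)
    moreover have "0 < r x" using False r0[of x] by linarith
    ultimately show ?thesis using qy t by (simp add: field_simps)
  qed
  have Ax_add: "Ax (\<lambda>i. x i + t * y i) = (\<lambda>i. Ax x i + t * Ax y i)" for x y t
    by (auto simp: Ax_def fun_eq_iff algebra_simps sum.distrib sum_distrib_left)
  \<comment> \<open>Moving from the minimizer \<open>x0\<close> in direction \<open>y\<close> gives
    a nonnegative quadratic in \<open>t\<close>. Its linear coefficient must vanish, which is the
    eigenvector equation of the squared matrix in weak form.\<close>
  have crit: "(\<Sum>i<n. Ax x0 i * Ax y i) = m * (\<Sum>i<n. x0 i * y i)" for y
  proof -
    define b where "b = (\<Sum>i<n. Ax x0 i * Ax y i) - m * (\<Sum>i<n. x0 i * y i)"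
    have "0 \<le> (q y - m * r y) * t\<^sup>2 + 2 * b * t" for t
    proof -
      have "q (\<lambda>i. x0 i + t * y i) = q x0 + t\<^sup>2 * q y + 2 * t * (\<Sum>i<n. Ax x0 i * Ax y i)"
        by (simp add: q_def Ax_add power2_eq_square algebra_simps sum.distrib sum_distrib_left)
      moreover have "r (\<lambda>i. x0 i + t * y i) = r x0 + t\<^sup>2 * r y + 2 * t * (\<Sum>i<n. x0 i * y i)"
        by (simp add: r_def power2_eq_square algebra_simps sum.distrib sum_distrib_left)
      moreover have "q x0 = m * r x0" using x0 by (simp add: m_def S_def)
      ultimately show ?thesis using min[of "\<lambda>i. x0 i + t * y i"]
        by (simp add: b_def algebra_simps)
    qed
    then have "b = 0" by (rule quadratic_nonneg_imp_linear_zero)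
    then show ?thesis by (simp add: b_def)
  qed
  have AAx: "Ax (Ax x0) j = m * x0 j" if j: "j < n" for j
  proof -
    define y where "y = (\<lambda>i. if i = j then 1 else 0 :: real)"
    have "Ax y i = a j i" for i using j sym by (simp add: Ax_def y_def if_distrib cong: if_cong)
    then have "(\<Sum>i<n. Ax x0 i * Ax y i) = Ax (Ax x0) j"
      by (simp add: Ax_apply[of "Ax x0"] mult.commute)
    moreover have "(\<Sum>i<n. x0 i * y i) = x0 j" using j by (simp add: y_def if_distrib cong: if_cong)
    ultimately show ?thesis using crit[of y] by simp
  qed
  have m0: "0 \<le> m" by (simp add: m_def q_def sum_nonneg)
  define s where "s = sqrt m"
  have ss: "s * s = m" "0 \<le> s" using m0 by (auto simp: s_def)
  \<comment> \<open>Since A^2 x0 = s^2 x0, the matrix A - s annihilates \<open>z\<close>. Either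
    \<open>z\<close> is an eigenvector for \<open>s\<close>, or it vanishes and \<open>x0\<close> is
    an eigenvector for \<open>- s\<close>.\<close>
  define z where "z = (\<lambda>i. Ax x0 i + s * x0 i)"
  have "\<exists>\<mu>. \<bar>\<mu>\<bar> = s \<and> eigenvalue (mat n n (\<lambda>(i, j). a i j)) \<mu>"
  proof (cases "\<forall>i<n. z i = 0")
    case True
    have "\<exists>i<n. x0 i \<noteq> 0"
    proof (rule ccontr)
      assume "\<not> ?thesis"
      then have "r x0 = 0" by (simp add: r_def)
      then show False using x0 by (simp add: S_def)
    qed
    moreover have "(\<Sum>j<n. a i j * x0 j) = - s * x0 i" if "i < n" for i
      using True that unfolding z_def Ax_def by (simp add: eq_neg_iff_add_eq_0)
    ultimately have "eigenvalue (mat n n (\<lambda>(i, j). a i j)) (- s)"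
      unfolding eigenvalue_sum_iff by blast
    then show ?thesis using ss by (intro exI[of _ "- s"]) auto
  next
    case False
    have "(\<Sum>j<n. a i j * z j) = s * z i" if "i < n" for i
    proof -
      have "(\<Sum>j<n. a i j * z j) = Ax z i" by (simp add: Ax_def)
      also have "\<dots> = m * x0 i + s * Ax x0 i" unfolding z_def Ax_add using AAx that by simp
      also have "\<dots> = s * z i" by (simp add: z_def algebra_simps flip: ss(1))
      finally show ?thesis .
    qed
    then have "eigenvalue (mat n n (\<lambda>(i, j). a i j)) s"
      unfolding eigenvalue_sum_iff using False by blast
    then show ?thesis using ss by (intro exI[of _ s]) auto
  qed
  then have "c < s" using big by auto
  then have "c\<^sup>2 < m" using c ss by (metis power2_eq_square power_strict_mono zero_less_numeral)
  then show ?thesis using that min unfolding q_def r_def Ax_def by blast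
qed

text \<open>Conjugation with the diagonal matrix \<open>S\<close> of colour signs negates every
  entry between different colours. No other entry is nonzero, so \<open>A\<close> is similar to
  \<open>- A\<close>.\<close>

lemma adj_matrix_eigenvalue_neg:
  assumes bs: "char_poly (adj_matrix n E) = (\<Prod>b\<leftarrow>bs. [:- b, 1:])" "length bs = n"
    and bip: "bipartite_graph n E"
  shows "mset (map uminus bs) = mset bs"
proof -
  define A where "A = adj_matrix n E"
  obtain col :: "nat \<Rightarrow> bool" where col: "\<forall>u<n. \<forall>v<n. E u v \<longrightarrow> col u \<noteq> col v"
    using bip unfolding bipartite_graph_def by blast
  define d where "d = (\<lambda>i. if col i then 1 else - 1 :: real)"
  define S where "S = mat n n (\<lambda>(i, j). if i = j then d i else 0)"
  have carr: "A \<in> carrier_mat n n" "S \<in> carrier_mat n n" "- A \<in> carrier_mat n n"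
    by (auto simp: A_def S_def adj_matrix_def)
  have SM: "(S * M) $$ (i, j) = d i * M $$ (i, j)" if "i < n" "j < n" "M \<in> carrier_mat n n" for M i j
    using that by (auto simp: S_def scalar_prod_def if_distrib[of "\<lambda>a. a * _"] cong: if_cong)
  have MS: "(M * S) $$ (i, j) = M $$ (i, j) * d j" if "i < n" "j < n" "M \<in> carrier_mat n n" for M i j
    using that by (auto simp: S_def scalar_prod_def if_distrib[of "\<lambda>a. _ * a"] cong: if_cong)
  have SS: "S * S = 1\<^sub>m n"
  proof (rule eq_matI)
    fix i j assume "i < dim_row (1\<^sub>m n :: real mat)" "j < dim_col (1\<^sub>m n :: real mat)"
    then have ij: "i < n" "j < n" by auto
    then show "(S * S) $$ (i, j) = 1\<^sub>m n $$ (i, j)"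
      by (subst SM[OF ij carr(2)]) (auto simp: S_def d_def)
  qed (auto simp: S_def)
  have "A = S * (- A) * S"
  proof (rule eq_matI)
    fix i j assume "i < dim_row (S * (- A) * S)" "j < dim_col (S * (- A) * S)"
    then have ij: "i < n" "j < n" by (auto simp: S_def)
    have "S * (- A) \<in> carrier_mat n n" using carr by auto
    then have "(S * (- A) * S) $$ (i, j) = d i * (- A) $$ (i, j) * d j"
      by (simp only: MS[OF ij] SM[OF ij carr(3)])
    then show "A $$ (i, j) = (S * (- A) * S) $$ (i, j)"
      using ij col[rule_format, of i j] by (auto simp: A_def adj_matrix_def d_def)
  qed (auto simp: A_def S_def adj_matrix_def)
  then have "similar_mat_wit A (- A) S S"
    using SS carr by (auto simp: similar_mat_wit_def Let_def A_def adj_matrix_def)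
  then have sim: "char_poly A = char_poly (- A)"
    by (intro char_poly_similar) (auto simp: similar_mat_def)
  have P: "poly (char_poly A) x = (\<Prod>b\<leftarrow>bs. x - b)" for x
    by (simp add: A_def bs poly_prod_list o_def)
  have "poly (\<Prod>b\<leftarrow>map uminus bs. [:- b, 1:]) x = poly (\<Prod>b\<leftarrow>bs. [:- b, 1:]) x" for x
  proof -
    \<comment> \<open>The characteristic polynomial of \<open>- A\<close> at \<open>x\<close> is
      that of \<open>A\<close> at \<open>- x\<close> up to the sign \<open>(- 1) ^ n\<close>, which
      the \<open>n\<close> linear factors absorb.\<close>
    have "(\<Prod>b\<leftarrow>bs. x - b) = det (- char_matrix (- A) x)"
      using char_poly_matrix[OF carr(3), of x] P[of x] sim by simp
    also have "- char_matrix (- A) x = (- 1) \<cdot>\<^sub>m (- char_matrix A (- x))"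
      using carr by (intro eq_matI) (auto simp: char_matrix_def)
    also have "det \<dots> = (- 1) ^ n * (\<Prod>b\<leftarrow>bs. - x - b)"
      using char_poly_matrix[OF carr(1), of "- x"] P[of "- x"] carr by (simp add: char_matrix_def)
    also have "\<dots> = (\<Prod>b\<leftarrow>bs. b + x)"
      unfolding bs(2)[symmetric] by (induction bs) (auto simp: algebra_simps)
    finally show ?thesis by (simp add: poly_prod_list o_def)
  qed
  then have "(\<Prod>b\<leftarrow>map uminus bs. [:- b, 1:]) = (\<Prod>b\<leftarrow>bs. [:- b, 1:])"
    by (intro poly_eq_poly_eq_iff[THEN iffD1] ext)
  then show ?thesis by (metis proots_linear_factors)
qed

text \<open>Negation reverses the sorted spectrum, so the medians have least absolute value among
  all eigenvalues. The HL-index is used below only in this form.\<close>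

lemma HL_index_eigenvalue:
  assumes simple: "simple_graph n E" and bip: "bipartite_graph n E" and n: "0 < n"
  shows "\<exists>\<mu>. eigenvalue (adj_matrix n E) \<mu> \<and> HL_index n E = \<bar>\<mu>\<bar>"
    and "eigenvalue (adj_matrix n E) \<mu> \<Longrightarrow> HL_index n E \<le> \<bar>\<mu>\<bar>"
proof -
  define A where "A = adj_matrix n E"
  have A: "A \<in> carrier_mat n n" by (simp add: A_def adj_matrix_def)
  define a where "a = (\<lambda>i j. if i < n \<and> j < n \<and> E i j then 1 else 0 :: real)"
  have "A = mat n n (\<lambda>(i, j). a i j)" by (rule eq_matI) (auto simp: A_def adj_matrix_def a_def)
  moreover have "a i j = a j i" for i j using simple by (auto simp: a_def simple_graph_def)
  ultimately obtain bs where bs: "length bs = n" "char_poly A = (\<Prod>b\<leftarrow>bs. [:- b, 1:])"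
    using real_symmetric_char_poly[of a n] by metis
  define xs where "xs = sorted_list_of_multiset (mset bs)"
  have xs: "mset xs = mset bs" "sorted xs" by (auto simp: xs_def)
  have len: "length xs = n" using xs(1) bs(1) by (metis size_mset)
  have "mset (rev (map uminus xs)) = mset (map uminus bs)"
    using xs(1) by (simp add: mset_map[symmetric] del: mset_map) (simp add: xs(1))
  then have "mset (rev (map uminus xs)) = mset xs"
    using adj_matrix_eigenvalue_neg[of n E bs] bs bip xs(1) by (simp add: A_def)
  moreover have "sorted (rev (map uminus xs))"
    using xs(2) by (auto simp: sorted_iff_nth_mono rev_nth len)
  ultimately have rev: "rev (map uminus xs) = xs"
    using xs(2) by (metis properties_for_sort sorted_sort_id)
  have nth: "xs ! (n - 1 - i) = - xs ! i" if "i < n" for i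
    using arg_cong[OF rev, of "\<lambda>l. l ! (n - 1 - i)"] that n
    by (simp add: rev_nth len Suc_diff_Suc)
  \<comment> \<open>\<open>eig\<close> counts from 1 in decreasing order, \<open>xs\<close> from 0
    in increasing order. By the symmetry the change of order costs only a sign.\<close>
  have eig: "eig n E (Suc i) = - xs ! i" if "i < n" for i
  proof -
    have "eig n E (Suc i) = rev xs ! i"
      using bs(2) by (simp add: eig_def A_def[symmetric] proots_linear_factors xs_def)
    then show ?thesis using that nth[OF that] by (simp add: rev_nth len)
  qed
  have ev: "eigenvalue A \<mu> \<longleftrightarrow> (\<exists>i<n. xs ! i = \<mu>)" for \<mu>
  proof -
    have "eigenvalue A \<mu> \<longleftrightarrow> \<mu> \<in> set bs"
      using eigenvalue_root_char_poly[OF A, of \<mu>]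
      by (auto simp: bs poly_prod_list prod_list_zero_iff)
    also have "set bs = set xs" using xs(1) by (metis set_mset_mset)
    finally show ?thesis by (auto simp: in_set_conv_nth len)
  qed
  define k where "k = n div 2"
  \<comment> \<open>For even \<open>n\<close> the medians are \<open>xs ! k\<close> and its negative
    \<open>xs ! (k - 1)\<close>; for odd \<open>n\<close> the only median is its own negative, hence
    0.\<close>
  have "\<exists>h<n. HL_index n E = \<bar>xs ! h\<bar> \<and> (\<forall>i<n. \<bar>xs ! h\<bar> \<le> \<bar>xs ! i\<bar>)"
  proof (cases "even n")
    case True
    then have nk: "n = 2 * k" and k: "0 < k" using n by (auto simp: k_def)
    have idx: "(n + 1) div 2 = Suc (k - 1)" "(n + 2) div 2 = Suc k" using nk k by auto
    have sym: "xs ! k = - xs ! (k - 1)" using nth[of "k - 1"] nk k by (simp add: mult_2)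
    have "xs ! (k - 1) \<le> xs ! k" using xs(2) nk k len by (intro sorted_nth_mono) auto
    then have pos: "0 \<le> xs ! k" using sym by linarith
    have "\<bar>xs ! k\<bar> \<le> \<bar>xs ! i\<bar>" if "i < n" for i
    proof (cases "i < k")
      case True
      then have "xs ! i \<le> xs ! (k - 1)" using xs(2) nk len by (intro sorted_nth_mono) auto
      then show ?thesis using sym pos by linarith
    next
      case False
      then have "xs ! k \<le> xs ! i" using xs(2) that len by (intro sorted_nth_mono) auto
      then show ?thesis using pos by linarith
    qed
    moreover have "HL_index n E = \<bar>xs ! k\<bar>"
      unfolding HL_index_def idx using sym eig[of "k - 1"] eig[of k] nk k by simp
    moreover have "k < n" using nk k by simp
    ultimately show ?thesis by blast
  next
    case False
    then have nk: "n = 2 * k + 1" by (simp add: k_def)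
    have idx: "(n + 1) div 2 = Suc k" "(n + 2) div 2 = Suc k" using nk by auto
    have "xs ! k = 0" using nth[of k] nk by (simp add: mult_2)
    moreover have "HL_index n E = \<bar>xs ! k\<bar>" unfolding HL_index_def idx using eig[of k] nk by simp
    moreover have "k < n" using nk by simp
    ultimately show ?thesis by fastforce
  qed
  then show "\<exists>\<mu>. eigenvalue (adj_matrix n E) \<mu> \<and> HL_index n E = \<bar>\<mu>\<bar>"
    and "eigenvalue (adj_matrix n E) \<mu> \<Longrightarrow> HL_index n E \<le> \<bar>\<mu>\<bar>"
    using ev unfolding A_def by auto
qed

section \<open>Lattices with a basis of roots\<close>

definition gram_form :: "'a set \<Rightarrow> ('a \<Rightarrow> 'a \<Rightarrow> int) \<Rightarrow> ('a \<Rightarrow> int) \<Rightarrow> ('a \<Rightarrow> int) \<Rightarrow> int" where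
  "gram_form V g x y = (\<Sum>u\<in>V. \<Sum>v\<in>V. x u * y v * g u v)"

definition unit_fun :: "'a \<Rightarrow> 'a \<Rightarrow> int" where
  "unit_fun u = (\<lambda>v. if v = u then 1 else 0)"

definition ind_fun :: "'a set \<Rightarrow> 'a \<Rightarrow> int" where
  "ind_fun D = (\<lambda>v. if v \<in> D then 1 else 0)"

definition scale_fun :: "int \<Rightarrow> ('a \<Rightarrow> int) \<Rightarrow> 'a \<Rightarrow> int" where
  "scale_fun c x = (\<lambda>v. c * x v)"

text \<open>Fixing the value 0 outside \<open>V\<close> makes two lattice vectors equal as functions
  as soon as their coordinates on \<open>V\<close> agree.\<close>

definition supp_in :: "'a set \<Rightarrow> ('a \<Rightarrow> int) set" where
  "supp_in V = {x. \<forall>u. u \<notin> V \<longrightarrow> x u = 0}"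

locale pos_lattice =
  fixes V :: "'a set" and g :: "'a \<Rightarrow> 'a \<Rightarrow> int"
  assumes finV: "finite V"
    and g_sym: "g u v = g v u"
    and pos: "x \<in> supp_in V \<Longrightarrow> x \<noteq> 0 \<Longrightarrow> 0 < gram_form V g x x"
begin

abbreviation ip where "ip \<equiv> gram_form V g"
abbreviation e where "e \<equiv> unit_fun"

lemma ip_sym: "ip x y = ip y x"
  unfolding gram_form_def by (subst sum.swap) (simp add: mult.commute mult.left_commute g_sym)

lemma ip_add_left: "ip (x + y) z = ip x z + ip y z"
  by (simp add: gram_form_def distrib_right sum.distrib)

lemma ip_diff_left: "ip (x - y) z = ip x z - ip y z"
  by (simp add: gram_form_def left_diff_distrib sum_subtractf)

lemma ip_minus_left: "ip (- x) z = - ip x z"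
  by (simp add: gram_form_def sum_negf)

lemma ip_scale_left: "ip (scale_fun c x) z = c * ip x z"
  by (simp add: gram_form_def scale_fun_def sum_distrib_left mult.assoc)

lemma ip_add_right: "ip z (x + y) = ip z x + ip z y"
  by (metis ip_sym ip_add_left)

lemma ip_diff_right: "ip z (x - y) = ip z x - ip z y"
  by (metis ip_sym ip_diff_left)

lemma ip_minus_right: "ip z (- x) = - ip z x"
  by (metis ip_sym ip_minus_left)

lemma ip_scale_right: "ip z (scale_fun c x) = c * ip z x"
  by (metis ip_sym ip_scale_left)

lemmas ip_linear = ip_add_left ip_add_right ip_diff_left ip_diff_right
  ip_minus_left ip_minus_right ip_scale_left ip_scale_right

lemma ip_sum_left: "ip (\<lambda>v. \<Sum>w\<in>S. f w v) z = (\<Sum>w\<in>S. ip (f w) z)"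
proof -
  have "ip (\<lambda>v. \<Sum>w\<in>S. f w v) z = (\<Sum>u\<in>V. \<Sum>w\<in>S. \<Sum>v\<in>V. f w u * z v * g u v)"
    unfolding gram_form_def sum_distrib_right
    by (rule sum.cong[OF refl], rule sum.swap)
  also have "\<dots> = (\<Sum>w\<in>S. ip (f w) z)"
    unfolding gram_form_def by (rule sum.swap)
  finally show ?thesis .
qed

lemma ip_unit_left: "u \<in> V \<Longrightarrow> ip (e u) y = (\<Sum>v\<in>V. y v * g u v)"
  unfolding gram_form_def unit_fun_def using finV
  by (subst sum.mono_neutral_right[of _ "{u}"]) auto

lemma ip_unit_unit: "u \<in> V \<Longrightarrow> v \<in> V \<Longrightarrow> ip (e u) (e v) = g u v"
  using finV by (simp add: ip_unit_left) (simp add: unit_fun_def if_distrib[of "\<lambda>a. a * _"] cong: if_cong)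

lemma ip_expand: "ip x y = (\<Sum>u\<in>V. x u * ip (e u) y)"
  unfolding gram_form_def[of V g x]
  by (rule sum.cong) (auto simp: ip_unit_left sum_distrib_left mult.assoc)

lemma ip_ind: "D \<subseteq> V \<Longrightarrow> ip (ind_fun D) y = (\<Sum>u\<in>D. ip (e u) y)"
  using finV by (subst ip_expand) (auto simp: ind_fun_def intro!: sum.mono_neutral_cong_right)

lemma unit_supp: "u \<in> V \<Longrightarrow> e u \<in> supp_in V"
  by (auto simp: supp_in_def unit_fun_def)

lemma add_supp: "x \<in> supp_in V \<Longrightarrow> y \<in> supp_in V \<Longrightarrow> x + y \<in> supp_in V"
  by (auto simp: supp_in_def)

lemma diff_supp: "x \<in> supp_in V \<Longrightarrow> y \<in> supp_in V \<Longrightarrow> x - y \<in> supp_in V"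
  by (auto simp: supp_in_def)

lemma minus_supp: "x \<in> supp_in V \<Longrightarrow> - x \<in> supp_in V"
  by (auto simp: supp_in_def)

lemma scale_supp: "x \<in> supp_in V \<Longrightarrow> scale_fun c x \<in> supp_in V"
  by (auto simp: supp_in_def scale_fun_def)

lemma ind_supp: "D \<subseteq> V \<Longrightarrow> ind_fun D \<in> supp_in V"
  by (auto simp: supp_in_def ind_fun_def)

lemmas supp_intros = unit_supp add_supp diff_supp minus_supp scale_supp ind_supp

text \<open>Such an \<open>x\<close> has norm 0. This proves identities between vectors by pairing
  the difference of both sides with the basis.\<close>

lemma nondeg: "x \<in> supp_in V \<Longrightarrow> (\<And>u. u \<in> V \<Longrightarrow> ip x (e u) = 0) \<Longrightarrow> x = 0"
  using pos[of x] ip_expand[of x x] by (auto simp: ip_sym)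

text \<open>The usual source of contradictions below: an explicit integer combination of norm at
  most 0 must vanish, although one of its coordinates does not.\<close>

lemma not_pos_zero: "x \<in> supp_in V \<Longrightarrow> ip x x \<le> 0 \<Longrightarrow> x = 0"
  using pos[of x] by force

section \<open>Roots and heights\<close>

definition roots :: "('a \<Rightarrow> int) set" where
  "roots = {x \<in> supp_in V. ip x x = 2}"

text \<open>Both \<open>a - b\<close> and \<open>a + b\<close> are nonzero, so 4 - 2 (a, b) and 4 +
  2 (a, b) are positive.\<close>

lemma root_ip_cases:
  assumes "a \<in> roots" "b \<in> roots" "a \<noteq> b" "a \<noteq> - b"
  shows "ip a b \<in> {-1, 0, 1}"
proof -
  have "a - b \<noteq> 0" "a + b \<noteq> 0"
    using assms by (auto simp: eq_neg_iff_add_eq_0)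
  then have "0 < ip (a - b) (a - b)" "0 < ip (a + b) (a + b)"
    using assms by (auto intro!: pos supp_intros simp: roots_def)
  then show ?thesis using assms by (auto simp: ip_linear roots_def ip_sym[of b a])
qed

lemma root_add: "a \<in> roots \<Longrightarrow> b \<in> roots \<Longrightarrow> ip a b = -1 \<Longrightarrow> a + b \<in> roots"
  by (auto simp: ip_linear roots_def ip_sym[of b a] intro!: supp_intros)

definition ht :: "('a \<Rightarrow> int) \<Rightarrow> int" where
  "ht x = (\<Sum>u\<in>V. x u)"

lemma ht_linear: "ht (x + y) = ht x + ht y" "ht (x - y) = ht x - ht y" "ht (- x) = - ht x"
  "ht (scale_fun c x) = c * ht x"
  by (simp_all add: ht_def sum.distrib sum_subtractf sum_negf scale_fun_def sum_distrib_left)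

lemma ht_unit: "u \<in> V \<Longrightarrow> ht (e u) = 1"
  using finV by (simp add: ht_def unit_fun_def)

end

text \<open>\<open>K\<close> will be D^2 - D + 2, which is at least 8 for D at least 3. Finiteness
  of \<open>roots\<close> allows a root of maximal height to be chosen and sums over roots to be
  formed.\<close>

locale regular_lattice = pos_lattice +
  fixes K :: int
  assumes g_diag: "u \<in> V \<Longrightarrow> g u u = 2"
    and g_off: "u \<in> V \<Longrightarrow> v \<in> V \<Longrightarrow> u \<noteq> v \<Longrightarrow> g u v \<in> {0, 1}"
    and g_row: "u \<in> V \<Longrightarrow> (\<Sum>v\<in>V. g u v) = K"
    and K8: "8 \<le> K"
    and fin_roots: "finite roots"
    and conn: "u \<in> V \<Longrightarrow> v \<in> V \<Longrightarrow> (\<lambda>x y. x \<in> V \<and> y \<in> V \<and> g x y = 1)\<^sup>*\<^sup>* u v"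
    and V_ne: "V \<noteq> {}"
begin

lemma g_nonneg: "u \<in> V \<Longrightarrow> v \<in> V \<Longrightarrow> 0 \<le> g u v"
  using g_diag[of u] g_off[of u v] by (cases "u = v") auto

lemma unit_root: "u \<in> V \<Longrightarrow> e u \<in> roots"
  by (simp add: roots_def unit_supp ip_unit_unit g_diag)

text \<open>The all-ones vector has product \<open>K\<close> with every basis vector, so pairing
  with it measures the height.\<close>

lemma ip_one: "ip x (ind_fun V) = K * ht x"
proof -
  have "ip x (ind_fun V) = (\<Sum>u\<in>V. x u * (\<Sum>v\<in>V. g u v))"
    by (subst ip_expand) (simp add: ip_unit_left ind_fun_def)
  then show ?thesis by (simp add: g_row ht_def sum_distrib_left mult.commute)
qed

lemma sum_ip_unit: "(\<Sum>u\<in>V. ip x (e u)) = K * ht x"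
  using ip_ind[of V x] ip_one[of x] by (simp add: ip_sym)

text \<open>Let \<open>h\<close> be a root of maximal height \<open>s\<close>. By maximality its products with the basis are 0 or 1,
  so it has product 1 with exactly \<open>t = K s\<close> of them, forming \<open>D\<close>; as rows of the Gram matrix sum to \<open>K\<close>,
  the vector \<open>t h - 2 \<Sum>D\<close> has norm at most \<open>2 t (2 K - t)\<close>, which is not positive for \<open>s \<ge> 2\<close>.\<close>

lemma ht_le_1:
  assumes "w \<in> roots" shows "ht w \<le> 1"
proof (rule ccontr)
  assume "\<not> ht w \<le> 1"
  define s where "s = Max (ht ` roots)"
  have "s \<in> ht ` roots" unfolding s_def using assms fin_roots by (intro Max_in) auto
  then obtain h where h: "h \<in> roots" "ht h = s" by auto
  have s_max: "x \<in> roots \<Longrightarrow> ht x \<le> s" for x unfolding s_def using fin_roots by auto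
  have s2: "2 \<le> s" using \<open>\<not> ht w \<le> 1\<close> s_max[OF assms] by linarith
  have h01: "ip h (e u) \<in> {0, 1}" if "u \<in> V" for u
  proof -
    have "ip h (e u) \<in> {-1, 0, 1}"
      using h s2 that by (intro root_ip_cases unit_root) (auto simp: ht_linear ht_unit)
    moreover have "ip h (e u) \<noteq> -1"
      using root_add[OF h(1) unit_root[OF that]] s_max[of "h + e u"] h that
      by (auto simp: ht_linear ht_unit)
    ultimately show ?thesis by auto
  qed
  define D where "D = {u \<in> V. ip h (e u) = 1}"
  have DV: "D \<subseteq> V" by (auto simp: D_def)
  define t where "t = K * s"
  have t: "2 * K \<le> t" using s2 K8 by (simp add: t_def)
  have "(\<Sum>u\<in>V. ip h (e u)) = (\<Sum>u\<in>D. 1)"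
    using finV h01 by (intro sum.mono_neutral_cong_right) (auto simp: D_def)
  then have cardD: "int (card D) = t" by (simp add: sum_ip_unit h t_def)
  have hd: "ip h (ind_fun D) = t"
    using cardD by (subst ip_sym, subst ip_ind[OF DV]) (simp add: D_def ip_sym)
  have "ip (e u) (ind_fun D) \<le> K" if "u \<in> D" for u
  proof -
    have "ip (e u) (ind_fun D) \<le> (\<Sum>v\<in>V. g u v)"
      using that DV g_nonneg by (subst ip_unit_left) (auto intro!: sum_mono simp: ind_fun_def)
    then show ?thesis using g_row that DV by auto
  qed
  then have "ip (ind_fun D) (ind_fun D) \<le> (\<Sum>u\<in>D. K)"
    by (subst ip_ind[OF DV]) (rule sum_mono)
  then have dd: "ip (ind_fun D) (ind_fun D) \<le> t * K" by (simp add: cardD)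
  define z where "z = scale_fun t h - scale_fun 2 (ind_fun D)"
  have "ip z z = 2 * t * t - 4 * t * t + 4 * ip (ind_fun D) (ind_fun D)"
    using h(1) hd by (simp add: z_def ip_linear roots_def ip_sym[of "ind_fun D" h])
  also have "\<dots> \<le> 2 * (t * (2 * K - t))" using dd by (simp add: algebra_simps)
  also have "\<dots> \<le> 0" using t K8 by (simp add: mult_nonneg_nonpos)
  finally have "z = 0"
    using h(1) DV by (intro not_pos_zero) (auto simp: z_def roots_def intro!: supp_intros)
  have "D \<noteq> {}" using cardD t K8 by auto
  then obtain u where u: "u \<in> D" by auto
  \<comment> \<open>The coordinate of \<open>z\<close> at a member of \<open>D\<close> is
    \<open>t * h u - 2\<close>, and it cannot vanish because \<open>t\<close> is at least
    16.\<close>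
  have "t * h u = 2" using \<open>z = 0\<close> u
    by (auto simp: z_def scale_fun_def ind_fun_def fun_eq_iff dest!: spec[of _ u])
  then have "t dvd 2" by (metis dvd_triv_left)
  then show False using t K8 zdvd_imp_le[of t 2] by auto
qed

section \<open>Roots of height 1\<close>

definition tops :: "('a \<Rightarrow> int) set" where
  "tops = {w \<in> roots. ht w = 1}"

lemma fin_tops: "finite tops"
  using fin_roots by (simp add: tops_def)

lemma unit_tops: "u \<in> V \<Longrightarrow> e u \<in> tops"
  by (simp add: tops_def unit_root ht_unit)

text \<open>A product -1 would make \<open>a + b\<close> a root of height 2, and
  \<open>a = - b\<close> is impossible for vectors of height 1.\<close>

lemma tops_ip:
  assumes "a \<in> tops" "b \<in> tops" "a \<noteq> b" shows "ip a b \<in> {0, 1}"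
proof -
  have "ip a b \<in> {-1, 0, 1}" using assms by (intro root_ip_cases) (auto simp: tops_def ht_linear)
  moreover have "ip a b \<noteq> -1"
    using root_add[of a b] ht_le_1[of "a + b"] assms by (auto simp: tops_def ht_linear)
  ultimately show ?thesis by auto
qed

text \<open>Otherwise \<open>e x + e y + e z - e v\<close> has norm 8 - 6 = 2, hence is a root, and
  its height is 2.\<close>

lemma no_claw:
  assumes V: "v \<in> V" "x \<in> V" "y \<in> V" "z \<in> V"
    and "g v x = 1" "g v y = 1" "g v z = 1"
  shows "g x y \<noteq> 0 \<or> g x z \<noteq> 0 \<or> g y z \<noteq> 0"
proof (rule ccontr)
  assume "\<not> ?thesis"
  then have "e x + e y + e z - e v \<in> roots"
    using assms g_sym
    by (auto simp: roots_def ip_linear ip_unit_unit g_diag intro!: supp_intros)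
  then show False using ht_le_1[of "e x + e y + e z - e v"] V by (auto simp: ht_linear ht_unit)
qed

text \<open>The alternating sum around a chordless 4-cycle has norm 8 - 8 = 0 without being
  zero.\<close>

lemma no_square:
  assumes V: "x \<in> V" "y \<in> V" "v \<in> V" "z \<in> V" and "x \<noteq> y" "v \<noteq> z"
    and "g x y = 0" "g x v = 1" "g y v = 1" "g x z = 1" "g y z = 1"
  shows "g v z = 1"
proof (rule ccontr)
  assume "g v z \<noteq> 1"
  then have "g v z = 0" using g_off[of v z] assms by auto
  then have "ip (e x + e y - e v - e z) (e x + e y - e v - e z) = 0"
    using assms g_sym by (simp add: ip_linear ip_unit_unit g_diag)
  then have "e x + e y - e v - e z = 0"
    using V by (intro not_pos_zero supp_intros) auto
  then have "(e x + e y - e v - e z) x = 0" by simp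
  moreover have "x \<noteq> v" "x \<noteq> z" using assms by (auto simp: g_diag)
  ultimately show False using \<open>x \<noteq> y\<close> by (simp add: unit_fun_def)
qed

section \<open>Reflections and the moments of the roots of height 1\<close>

definition reflect :: "('a \<Rightarrow> int) \<Rightarrow> ('a \<Rightarrow> int) \<Rightarrow> 'a \<Rightarrow> int" where
  "reflect r w = w - scale_fun (ip w r) r"

lemma reflect_tops:
  assumes "r \<in> roots" "ht r = 0" "w \<in> tops" shows "reflect r w \<in> tops"
  using assms by (auto simp: reflect_def tops_def roots_def ip_linear ht_linear ip_sym[of r w]
      algebra_simps intro!: supp_intros)

lemma ip_reflect: "ip (reflect r w) y = ip w y - ip w r * ip r y"
  by (simp add: reflect_def ip_linear)

lemma reflect_reflect: "r \<in> roots \<Longrightarrow> reflect r (reflect r w) = w"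
  by (subst reflect_def) (auto simp: ip_reflect roots_def, auto simp: reflect_def scale_fun_def fun_eq_iff)

lemma sum_tops_reflect:
  assumes "r \<in> roots" "ht r = 0"
  shows "(\<Sum>w\<in>tops. f w) = (\<Sum>w\<in>tops. f (reflect r w))"
  by (rule sum.reindex_bij_witness[of _ "reflect r" "reflect r"])
    (use assms in \<open>auto simp: reflect_reflect reflect_tops\<close>)

definition moment :: "('a \<Rightarrow> int) \<Rightarrow> ('a \<Rightarrow> int) \<Rightarrow> int" where
  "moment x y = (\<Sum>w\<in>tops. ip w x * ip w y)"

text \<open>The reflection in \<open>r\<close> permutes \<open>tops\<close>, negates products with
  \<open>r\<close>, and changes the product with \<open>y\<close> by a multiple of the one with
  \<open>r\<close>. Reindexing the moment sum along it gives the equation.\<close>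

lemma moment_reflect:
  assumes "r \<in> roots" "ht r = 0"
  shows "2 * moment r y = ip r y * moment r r"
proof -
  have "moment r y = (\<Sum>w\<in>tops. (- ip w r) * (ip w y - ip w r * ip r y))"
    unfolding moment_def by (subst sum_tops_reflect[OF assms])
      (use assms in \<open>simp add: ip_reflect roots_def\<close>)
  also have "\<dots> = - moment r y + ip r y * moment r r"
    by (simp add: moment_def algebra_simps sum.distrib sum_subtractf sum_negf sum_distrib_left)
  finally show ?thesis by simp
qed

lemma moment_sym: "moment x y = moment y x" by (simp add: moment_def mult.commute)

lemma moment_diff: "moment (x - y) z = moment x z - moment y z"
  by (simp add: moment_def ip_linear algebra_simps sum_subtractf)

lemma edge_root:
  assumes "u \<in> V" "v \<in> V" "g u v = 1"
  shows "e u - e v \<in> roots" "ht (e u - e v) = 0"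
  using assms by (auto simp: roots_def ip_linear ip_unit_unit g_diag g_sym ht_linear ht_unit
      intro!: supp_intros)

definition edge_moment :: "'a \<Rightarrow> 'a \<Rightarrow> int" where "edge_moment u v = moment (e u - e v) (e u - e v)"

lemma edge_moment_sym: "edge_moment u v = edge_moment v u"
  by (simp add: edge_moment_def moment_def ip_linear power2_eq_square[symmetric] power2_commute)

text \<open>Apply \<open>moment_reflect\<close> to both differences. The mixed moment is then their
  product times half of either edge moment, and the nonzero product cancels.\<close>

lemma edge_moment_eq:
  assumes "u \<in> V" "v \<in> V" "g u v = 1" "x \<in> V" "y \<in> V" "g x y = 1"
    and "ip (e u - e v) (e x - e y) \<noteq> 0"
  shows "edge_moment u v = edge_moment x y"
proof -
  have "ip (e u - e v) (e x - e y) * edge_moment u v = ip (e u - e v) (e x - e y) * edge_moment x y"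
    using moment_reflect[of "e u - e v" "e x - e y"] moment_reflect[of "e x - e y" "e u - e v"]
      edge_root[of u v] edge_root[of x y] assms
    by (simp add: edge_moment_def moment_sym ip_sym)
  then show ?thesis using assms by simp
qed

lemma edge_moment_triangle:
  assumes "u \<in> V" "v \<in> V" "x \<in> V" "g u v = 1" "g u x = 1" "g v x = 1"
  shows "edge_moment u v = edge_moment u x"
  using assms by (intro edge_moment_eq) (auto simp: ip_linear ip_unit_unit g_diag g_sym)

lemma conn_induct:
  assumes "u \<in> V" "v \<in> V" "P u"
    and "\<And>x y. x \<in> V \<Longrightarrow> y \<in> V \<Longrightarrow> g x y = 1 \<Longrightarrow> P x \<Longrightarrow> P y"
  shows "P v"
  using conn[OF assms(1,2)] by (induction rule: rtranclp_induct) (use assms in auto)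

text \<open>Reflection in the difference of adjacent basis vectors shows that the vector sum
  \<open>G\<close> of \<open>tops\<close> is orthogonal to it. By connectedness \<open>G\<close> has
  equal products with all basis vectors, hence is a multiple of the all-ones vector;
  \<open>k\<close> is its common coordinate.\<close>

lemma sum_tops:
  obtains k where "\<And>u. u \<in> V \<Longrightarrow> (\<Sum>w\<in>tops. ip w (e u)) = k * K"
    and "int (card tops) = k * int (card V)"
    and "\<And>y. (\<Sum>w\<in>tops. ip w y) = k * K * ht y"
proof -
  define C where "C = (\<lambda>u. \<Sum>w\<in>tops. ip w (e u))"
  have step: "C u = C v" if "u \<in> V" "v \<in> V" "g u v = 1" for u v
  proof -
    have "(\<Sum>w\<in>tops. ip w (e u - e v)) = - (\<Sum>w\<in>tops. ip w (e u - e v))"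
      using edge_root[OF that]
      by (subst sum_tops_reflect[of "e u - e v"]) (auto simp: ip_reflect roots_def sum_negf[symmetric])
    then show ?thesis by (simp add: C_def ip_linear sum_subtractf)
  qed
  obtain a0 where a0: "a0 \<in> V" using V_ne by auto
  have C: "C u = C a0" if "u \<in> V" for u
    by (rule conn_induct[OF a0 that, of "\<lambda>u. C u = C a0"]) (auto dest: step)
  define G where "G = (\<lambda>u. \<Sum>w\<in>tops. w u)"
  have ipG: "ip G y = (\<Sum>w\<in>tops. ip w y)" for y
    by (simp add: G_def ip_sum_left)
  have Gs: "G \<in> supp_in V"
    by (auto simp: G_def supp_in_def tops_def roots_def)
  \<comment> \<open>Multiplying \<open>G\<close> by \<open>K\<close> keeps the comparison with the
    all-ones vector inside the integer lattice.\<close>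
  define z where "z = scale_fun K G - scale_fun (C a0) (ind_fun V)"
  have "z = 0"
  proof (rule nondeg)
    show "z \<in> supp_in V" using Gs by (auto simp: z_def intro!: supp_intros)
    fix u assume "u \<in> V"
    then show "ip z (e u) = 0" using C[of u]
      by (simp add: z_def ip_linear ipG C_def ip_sym[of "ind_fun V"] ip_one ht_unit)
  qed
  then have KG: "K * G u = C a0" if "u \<in> V" for u
    using that by (auto simp: z_def scale_fun_def ind_fun_def fun_eq_iff split: if_splits dest!: spec[of _ u])
  have Gk: "G u = G a0" if "u \<in> V" for u
    using KG[OF that] KG[OF a0] K8 by (metis mult_cancel_left not_numeral_le_zero)
  have G_eq: "G = scale_fun (G a0) (ind_fun V)"
    using Gs Gk by (auto simp: supp_in_def scale_fun_def ind_fun_def fun_eq_iff)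
  show ?thesis
  proof
    show "(\<Sum>w\<in>tops. ip w y) = G a0 * K * ht y" for y
      using ipG[of y] ip_one[of y] ip_scale_left[of "G a0" "ind_fun V" y]
      by (simp add: ip_sym[of "ind_fun V" y] flip: G_eq)
    then show "(\<Sum>w\<in>tops. ip w (e u)) = G a0 * K" if "u \<in> V" for u
      using that by (simp add: ht_unit)
    have "int (card tops) = (\<Sum>w\<in>tops. ht w)" by (simp add: tops_def)
    also have "\<dots> = (\<Sum>u\<in>V. G u)" unfolding ht_def G_def by (rule sum.swap)
    also have "\<dots> = (\<Sum>u\<in>V. G a0)" using Gk by (rule sum.cong[OF refl])
    finally show "int (card tops) = G a0 * int (card V)" by simp
  qed
qed

lemma exists_neighbour:
  assumes "u \<in> V" shows "\<exists>v\<in>V. g u v = 1"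
proof (rule ccontr)
  assume "\<not> ?thesis"
  then have "(\<Sum>v\<in>V. g u v) = (\<Sum>v\<in>{u}. g u v)"
    using finV assms g_off by (intro sum.mono_neutral_right) auto
  then show False using assms g_row g_diag K8 by simp
qed

text \<open>Local equality of edge moments spreads through the connected graph to a single value.
  \<open>moment_reflect\<close> then settles the differences along edges, and these telescope along
  walks.\<close>

lemma moment_single_class:
  assumes loc: "\<And>v x y. v \<in> V \<Longrightarrow> x \<in> V \<Longrightarrow> y \<in> V \<Longrightarrow> g v x = 1 \<Longrightarrow> g v y = 1 \<Longrightarrow> edge_moment v x = edge_moment v y"
  obtains \<mu> where "\<And>u v y. u \<in> V \<Longrightarrow> v \<in> V \<Longrightarrow> moment (e u - e v) y = \<mu> * ip (e u - e v) y"
proof -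
  obtain a0 where a0: "a0 \<in> V" using V_ne by auto
  obtain p where p: "p \<in> V" "g a0 p = 1" using exists_neighbour[OF a0] by auto
  have all: "\<forall>x\<in>V. g v x = 1 \<longrightarrow> edge_moment v x = edge_moment a0 p" if "v \<in> V" for v
    by (rule conn_induct[OF a0 that, of "\<lambda>v. \<forall>x\<in>V. g v x = 1 \<longrightarrow> edge_moment v x = edge_moment a0 p"])
      (use a0 p loc edge_moment_sym g_sym in metis)+
  \<comment> \<open>The difference has product 2 - 1 = 1 with \<open>e a0\<close>, so \<mu> is half
    the common edge moment, obtained without dividing.\<close>
  define \<mu> where "\<mu> = moment (e a0 - e p) (e a0)"
  have "edge_moment a0 p = 2 * \<mu>"
    using moment_reflect[of "e a0 - e p" "e a0"] edge_root[OF a0 p] a0 p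
    by (simp add: \<mu>_def edge_moment_def ip_linear ip_unit_unit g_diag g_sym)
  then have edge: "moment (e u - e v) y = \<mu> * ip (e u - e v) y" if "u \<in> V" "v \<in> V" "g u v = 1" for u v y
    using moment_reflect[of "e u - e v" y] edge_root[OF that] all[of u] that
    by (simp add: edge_moment_def[symmetric])
  have "moment (e u - e v) y = \<mu> * ip (e u - e v) y" if "u \<in> V" "v \<in> V" for u v y
  proof (rule conn_induct[OF that, of "\<lambda>v. moment (e u - e v) y = \<mu> * ip (e u - e v) y"])
    show "moment (e u - e u) y = \<mu> * ip (e u - e u) y" unfolding moment_diff ip_linear by simp
    fix a b assume "a \<in> V" "b \<in> V" "g a b = 1" "moment (e u - e a) y = \<mu> * ip (e u - e a) y"
    then show "moment (e u - e b) y = \<mu> * ip (e u - e b) y"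
      using edge[of a b y] by (simp add: moment_diff ip_linear algebra_simps)
  qed
  then show ?thesis by (rule that)
qed

text \<open>The moment form is \<open>\<mu>\<close> times the given form plus a multiple of the product of heights. The two
  equations come from evaluating it at a basis vector and from the trace of the associated operator.\<close>

lemma size_equation:
  assumes loc: "\<And>v x y. v \<in> V \<Longrightarrow> x \<in> V \<Longrightarrow> y \<in> V \<Longrightarrow> g v x = 1 \<Longrightarrow> g v y = 1 \<Longrightarrow> edge_moment v x = edge_moment v y"
  defines "m \<equiv> int (card V)"
  obtains k where "0 \<le> k" "k * (K * (K - 3) - (K - 4) * m) = 2 * (m - 1)"
proof -
  obtain k where k1: "\<And>u. u \<in> V \<Longrightarrow> (\<Sum>w\<in>tops. ip w (e u)) = k * K"
    and k2: "int (card tops) = k * m"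
    and k3: "\<And>y. (\<Sum>w\<in>tops. ip w y) = k * K * ht y"
    using sum_tops unfolding m_def by blast
  obtain \<mu> where \<mu>: "\<And>u v y. u \<in> V \<Longrightarrow> v \<in> V \<Longrightarrow> moment (e u - e v) y = \<mu> * ip (e u - e v) y"
    using moment_single_class[OF loc] by blast
  have m0: "m > 0" using finV V_ne by (auto simp: m_def card_gt_0_iff)
  \<comment> \<open>Sum \<open>moment (e u - e v) y\<close> over all \<open>v\<close>. The total of
    the \<open>moment (e v) y\<close> is known because every member of \<open>tops\<close> has total
    product \<open>K\<close> with the basis. The factor \<open>m\<close> avoids division.\<close>
  have moment_unit: "m * moment (e u) y = m * \<mu> * ip (e u) y + K * (k * K - \<mu>) * ht y" if u: "u \<in> V" for u y
  proof -
    have "(\<Sum>v\<in>V. moment (e v) y) = (\<Sum>w\<in>tops. (\<Sum>v\<in>V. ip w (e v)) * ip w y)"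
      unfolding moment_def sum_distrib_right by (rule sum.swap)
    also have "\<dots> = (\<Sum>w\<in>tops. K * ip w y)"
      by (rule sum.cong) (auto simp: sum_ip_unit tops_def)
    finally have S: "(\<Sum>v\<in>V. moment (e v) y) = K * (k * K * ht y)"
      by (simp add: k3 flip: sum_distrib_left)
    have "m * moment (e u) y - (\<Sum>v\<in>V. moment (e v) y) = (\<Sum>v\<in>V. moment (e u - e v) y)"
      by (simp add: moment_diff sum_subtractf m_def)
    also have "\<dots> = (\<Sum>v\<in>V. \<mu> * (ip (e u) y - ip y (e v)))"
      by (rule sum.cong) (auto simp: \<mu> u ip_linear ip_sym)
    also have "\<dots> = \<mu> * (m * ip (e u) y - K * ht y)"
      by (simp add: sum_distrib_left[symmetric] sum_subtractf sum_ip_unit m_def)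
    finally show ?thesis using S by (simp add: algebra_simps)
  qed
  obtain a0 where a0: "a0 \<in> V" using V_ne by auto
  \<comment> \<open>Products with \<open>e a0\<close> are 0 or 1 and equal their squares, except
    that \<open>e a0\<close> itself contributes 4 = 2 + 2.\<close>
  have "moment (e a0) (e a0) = (\<Sum>w\<in>tops. ip w (e a0) + (if w = e a0 then 2 else 0))"
    unfolding moment_def
  proof (rule sum.cong[OF refl])
    fix w assume "w \<in> tops"
    then show "ip w (e a0) * ip w (e a0) = ip w (e a0) + (if w = e a0 then 2 else 0)"
      using tops_ip[of w "e a0"] unit_tops[OF a0] a0
      by (cases "w = e a0") (auto simp: ip_unit_unit g_diag)
  qed
  also have "\<dots> = k * K + 2"
    using fin_tops unit_tops[OF a0] by (simp add: sum.distrib k1[OF a0])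
  finally have eq2: "m * (k * K + 2) = 2 * m * \<mu> + K * (k * K - \<mu>)"
    using moment_unit[OF a0, of "e a0"] a0 by (simp add: ip_unit_unit g_diag ht_unit)
  \<comment> \<open>\<open>T u\<close> is the vector representing \<open>moment (e u)\<close>. The
    trace of \<open>T\<close> is computed once from \<open>T_diag\<close> and once from the norms 2
    of the roots in \<open>tops\<close>.\<close>
  define T where "T = (\<lambda>u v. \<Sum>w\<in>tops. ip w (e u) * w v)"
  have T_diag: "m * T u u = m * \<mu> + (k * K - \<mu>)" if u: "u \<in> V" for u
  proof -
    have ipT: "ip (T u) y = moment (e u) y" for y
    proof -
      have "ip (T u) y = (\<Sum>w\<in>tops. ip (scale_fun (ip w (e u)) w) y)"
        unfolding T_def by (simp add: ip_sum_left[symmetric] scale_fun_def)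
      then show ?thesis by (simp add: ip_linear moment_def)
    qed
    define z where "z = scale_fun m (T u) - scale_fun (m * \<mu>) (e u) - scale_fun (k * K - \<mu>) (ind_fun V)"
    have "z = 0"
    proof (rule nondeg)
      have "T u \<in> supp_in V" by (auto simp: T_def supp_in_def tops_def roots_def)
      then show "z \<in> supp_in V" using u by (auto simp: z_def intro!: supp_intros)
      fix v assume v: "v \<in> V"
      show "ip z (e v) = 0" using moment_unit[OF u, of "e v"] v
        by (simp add: z_def ip_linear ipT ip_sym[of "ind_fun V"] ip_one ht_unit)
    qed
    then have "z u = 0" by simp
    then show ?thesis using u by (simp add: z_def scale_fun_def unit_fun_def ind_fun_def)
  qed
  have "(\<Sum>u\<in>V. T u u) = (\<Sum>w\<in>tops. \<Sum>u\<in>V. w u * ip (e u) w)"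
    unfolding T_def by (subst sum.swap) (simp add: mult.commute ip_sym)
  also have "\<dots> = 2 * (k * m)"
    by (simp add: ip_expand[symmetric]) (simp add: tops_def roots_def k2[symmetric] tops_def[symmetric])
  finally have "m * (2 * (k * m)) = (\<Sum>u\<in>V. m * T u u)" by (simp add: sum_distrib_left[symmetric])
  also have "\<dots> = (\<Sum>u\<in>V. m * \<mu> + (k * K - \<mu>))" by (rule sum.cong[OF refl T_diag])
  also have "\<dots> = m * (m * \<mu> + (k * K - \<mu>))" by (simp add: m_def)
  finally have "2 * (k * m) = m * \<mu> + (k * K - \<mu>)" using m0 by simp
  then have eq1: "2 * k * m = (m - 1) * \<mu> + k * K" by (simp add: algebra_simps)
  \<comment> \<open>Multiplying \<open>eq2\<close> by \<open>m - 1\<close> leaves \<mu> only in the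
    combination \<open>(m - 1) * \<mu>\<close>, which \<open>eq1\<close> eliminates.\<close>
  have "m * (k * (K * (K - 3) - (K - 4) * m)) = m * (2 * (m - 1))"
  proof -
    have mu: "(m - 1) * \<mu> = 2 * k * m - k * K" using eq1 by simp
    have "(m - 1) * (m * (k * K + 2)) = (2 * m - K) * ((m - 1) * \<mu>) + k * K * K * (m - 1)"
      by (subst eq2) (simp add: algebra_simps)
    then show ?thesis unfolding mu by (simp add: algebra_simps)
  qed
  then have "k * (K * (K - 3) - (K - 4) * m) = 2 * (m - 1)" using m0 by simp
  moreover have "0 \<le> k" using k2 m0 by (metis of_nat_0_le_iff zero_le_mult_iff not_less)
  ultimately show ?thesis using that by blast
qed

end

section \<open>From the size equation to completeness\<close>

context regular_lattice
begin

lemma card_nbrs: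
  assumes u: "u \<in> V"
  shows "int (card {v \<in> V. g u v = 1}) = K - 2"
proof -
  have "(\<Sum>v\<in>V. g u v) = g u u + (\<Sum>v\<in>V - {u}. g u v)"
    using finV u by (rule sum.remove)
  also have "(\<Sum>v\<in>V - {u}. g u v) = (\<Sum>v\<in>{v \<in> V. g u v = 1}. 1)"
    using finV g_off[OF u] g_diag[OF u] by (intro sum.mono_neutral_cong_right) auto
  finally show ?thesis using g_row[OF u] g_diag[OF u] by simp
qed

lemma card_non_nbrs:
  assumes u: "u \<in> V"
  shows "int (card {v \<in> V. v \<noteq> u \<and> g u v = 0}) = int (card V) - K + 1"
proof -
  let ?A = "{v \<in> V. g u v = 1}" and ?Z = "{v \<in> V. v \<noteq> u \<and> g u v = 0}"
  have "V = insert u (?A \<union> ?Z)" using u g_off[OF u] by auto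
  moreover have "u \<notin> ?A \<union> ?Z" using g_diag[OF u] by auto
  ultimately have "card V = Suc (card (?A \<union> ?Z))"
    using finV by (metis (no_types, lifting) card_insert_disjoint finite_insert)
  also have "card (?A \<union> ?Z) = card ?A + card ?Z"
    using finV by (intro card_Un_disjoint) auto
  finally show ?thesis using card_nbrs[OF u] by simp
qed

text \<open>Every basis vector is orthogonal to exactly \<open>d\<close> others. The size equation,
  rewritten in \<open>d\<close> and \<open>K\<close>, has a positive right side. This excludes
  \<open>d \<ge> 3\<close>, as \<open>K \<ge> 8\<close>, and \<open>d = 1\<close> would make
  \<open>K\<close> divide 2. The case \<open>d = 2\<close> needs a combinatorial argument.\<close>

lemma complete:
  assumes loc: "\<And>v x y. v \<in> V \<Longrightarrow> x \<in> V \<Longrightarrow> y \<in> V \<Longrightarrow> g v x = 1 \<Longrightarrow> g v y = 1 \<Longrightarrow> edge_moment v x = edge_moment v y"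
    and xy: "x \<in> V" "y \<in> V" "x \<noteq> y"
  shows "g x y = 1"
proof (rule ccontr)
  assume "g x y \<noteq> 1"
  then have gxy: "g x y = 0" using g_off[OF xy] by auto
  define Z where "Z = (\<lambda>u. {v \<in> V. v \<noteq> u \<and> g u v = 0})"
  define d where "d = int (card V) - K + 1"
  have cardZ: "int (card (Z u)) = d" if "u \<in> V" for u
    using card_non_nbrs[OF that] by (simp add: Z_def d_def)
  have finZ: "finite (Z u)" for u using finV by (auto simp: Z_def)
  have yZ: "y \<in> Z x" "x \<in> Z y" using gxy xy g_sym by (auto simp: Z_def)
  then have "card (Z x) \<noteq> 0" using finZ by auto
  then have d1: "1 \<le> d" using cardZ[OF xy(1)] by linarith
  obtain k where k0: "0 \<le> k" and "k * (K * (K - 3) - (K - 4) * int (card V)) = 2 * (int (card V) - 1)"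
    using size_equation[OF loc] by blast
  moreover have "int (card V) = d + K - 1" by (simp add: d_def)
  ultimately have k: "k * (K - (K - 4) * (d - 1)) = 2 * (d + K - 2)" by (simp add: algebra_simps)
  have kpos: "0 < k * (K - (K - 4) * (d - 1))" using k d1 K8 by simp
  have dle: "d \<le> 2"
  proof (rule ccontr)
    assume "\<not> d \<le> 2"
    then have "(K - 4) * 2 \<le> (K - 4) * (d - 1)" using K8 by (intro mult_left_mono) auto
    moreover have "K \<le> (K - 4) * 2" using K8 by simp
    ultimately have "K - (K - 4) * (d - 1) \<le> 0" by (simp only: diff_le_0_iff_le order.trans)
    then show False using kpos k0 by (simp add: zero_less_mult_iff)
  qed
  show False
  proof (cases "d = 1")
    case True
    then have "k * K = 2 * (K - 1)" using k by simp
    then have "K * (2 - k) = 2" by (simp add: algebra_simps)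
    then have "K dvd 2" by (metis dvd_triv_left)
    then show False using K8 zdvd_imp_le[of K 2] by auto
  next
    case False
    then have d2: "d = 2" using dle d1 by linarith
    then have card2: "card (Z u) = 2" if "u \<in> V" for u using cardZ[OF that] by simp
    obtain x2 where x2: "Z x = {y, x2}"
      using card2[OF xy(1)] yZ(1) unfolding card_2_iff by (metis insertE insert_commute singletonD)
    obtain y2 where y2: "Z y = {x, y2}"
      using card2[OF xy(2)] yZ(2) unfolding card_2_iff by (metis insertE insert_commute singletonD)
    \<comment> \<open>\<open>C\<close> consists of common neighbours of \<open>x\<close> and
      \<open>y\<close>, pairwise adjacent by \<open>no_square\<close>. So the two non-neighbours of
      each member are \<open>x2\<close> and \<open>y2\<close>, which gives \<open>x2\<close> more
      than two non-neighbours.\<close>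
    define C where "C = V - {x, y, x2, y2}"
    have "card V - card {x, y, x2, y2} \<le> card C"
      unfolding C_def by (intro diff_card_le_card_Diff) auto
    moreover have "card {x, y, x2, y2} \<le> 4"
      by (simp add: card_insert_if)
    ultimately have "2 < card C" using d2 K8 d_def by linarith
    have C: "g x c = 1" "g y c = 1" if "c \<in> C" for c
      using that x2 y2 g_off[OF xy(1), of c] g_off[OF xy(2), of c] unfolding C_def Z_def by auto
    have "c \<in> Z x2" if c: "c \<in> C" for c
    proof -
      have "Z c \<subseteq> {x2, y2}"
      proof
        fix z assume z: "z \<in> Z c"
        have "z \<notin> C"
        proof
          assume "z \<in> C"
          then have "g c z = 1"
            using z C[OF c] C[of z] c xy gxy by (intro no_square[of x y c z]) (auto simp: Z_def C_def)
          then show False using z by (simp add: Z_def)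
        qed
        moreover have "z \<noteq> x" "z \<noteq> y" using z C[OF c] g_sym by (auto simp: Z_def)
        ultimately show "z \<in> {x2, y2}" using z by (auto simp: C_def Z_def)
      qed
      moreover have "card (Z c) = 2" using card2 c by (simp add: C_def)
      moreover have "card {x2, y2} \<le> 2" by (simp add: card_insert_if)
      ultimately have "Z c = {x2, y2}" by (intro card_seteq) auto
      then show ?thesis using g_sym[of x2 c] c by (auto simp: Z_def C_def)
    qed
    then have "card C \<le> card (Z x2)" using finZ by (intro card_mono) auto
    moreover have "x2 \<in> V" using x2 by (auto simp: Z_def)
    ultimately show False using card2[of x2] \<open>2 < card C\<close> by simp
  qed
qed

end

section \<open>Incidence structures with a positive definite form\<close>

definition line_pts :: "'a set \<Rightarrow> ('a \<Rightarrow> 'b \<Rightarrow> bool) \<Rightarrow> 'b \<Rightarrow> 'a set" where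
  "line_pts P I l = {p \<in> P. I p l}"

text \<open>A line joining \<open>x\<close> to two different points of \<open>l\<close> would be
  \<open>l\<close> itself, which misses \<open>x\<close>. So the joining lines are distinct.\<close>

lemma join_embedding:
  assumes l: "\<not> I x l"
    and col: "\<And>b. b \<in> line_pts P I l \<Longrightarrow> \<exists>j\<in>L. I x j \<and> I b j"
    and uniq: "\<And>b c j. b \<in> P \<Longrightarrow> c \<in> P \<Longrightarrow> b \<noteq> c \<Longrightarrow> j \<in> L \<Longrightarrow>
      I b l \<Longrightarrow> I c l \<Longrightarrow> I b j \<Longrightarrow> I c j \<Longrightarrow> l = j"
  obtains f where "inj_on f (line_pts P I l)"
    "\<And>b. b \<in> line_pts P I l \<Longrightarrow> f b \<in> L \<and> I x (f b) \<and> I b (f b)"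
proof -
  obtain f where f: "\<And>b. b \<in> line_pts P I l \<Longrightarrow> f b \<in> L \<and> I x (f b) \<and> I b (f b)"
    using col by metis
  have "inj_on f (line_pts P I l)"
  proof (rule inj_onI, rule ccontr)
    fix b c assume bc: "b \<in> line_pts P I l" "c \<in> line_pts P I l" "f b = f c" "b \<noteq> c"
    then have "l = f b"
      using f[of b] f[of c] by (intro uniq[of b c]) (auto simp: line_pts_def)
    then show False using f[OF bc(1)] l by simp
  qed
  then show ?thesis using f that by blast
qed

text \<open>The matrix N N^T - (D - 2) I for the point-line incidence matrix N, that is, the block
  of A^2 - (D - 2) I on the points.\<close>

definition codeg_form :: "'b set \<Rightarrow> ('a \<Rightarrow> 'b \<Rightarrow> bool) \<Rightarrow> nat \<Rightarrow> 'a \<Rightarrow> 'a \<Rightarrow> int" where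
  "codeg_form L I D p q = int (card {l \<in> L. I p l \<and> I q l}) - (if p = q then int D - 2 else 0)"

locale pos_incidence =
  fixes P :: "'a set" and L :: "'b set" and I :: "'a \<Rightarrow> 'b \<Rightarrow> bool" and D :: nat
  assumes finP: "finite P" and finL: "finite L" and D3: "3 \<le> D"
    and deg_le: "p \<in> P \<Longrightarrow> card {l \<in> L. I p l} \<le> D"
    and posP: "x \<in> supp_in P \<Longrightarrow> x \<noteq> 0 \<Longrightarrow> 0 < gram_form P (codeg_form L I D) x x"
begin

sublocale pos_lattice P "codeg_form L I D"
  by unfold_locales (auto simp: finP posP codeg_form_def conj_commute)

abbreviation g where "g \<equiv> codeg_form L I D"

lemma g_self: "g p p = int (card {l \<in> L. I p l}) - int D + 2"
  by (simp add: codeg_form_def)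

lemma g_other: "p \<noteq> q \<Longrightarrow> g p q = int (card {l \<in> L. I p l \<and> I q l})"
  by (simp add: codeg_form_def)

lemma unit_diff_ne: "p \<noteq> q \<Longrightarrow> e p - e q \<noteq> 0"
  by (auto simp: unit_fun_def fun_eq_iff dest!: spec[of _ p])

lemma g_self_pos:
  assumes "p \<in> P" shows "0 < g p p"
proof -
  have "e p p \<noteq> 0" by (simp add: unit_fun_def)
  then have "e p \<noteq> 0" by (metis zero_fun_apply)
  then show ?thesis using pos[of "e p"] assms by (simp add: unit_supp ip_unit_unit)
qed

lemma g_self_le: "p \<in> P \<Longrightarrow> g p p \<le> 2"
  using deg_le by (simp add: g_self)

lemma deg_ge: "p \<in> P \<Longrightarrow> D - 1 \<le> card {l \<in> L. I p l}"
  using g_self_pos[of p] by (simp add: g_self)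

text \<open>The norm of \<open>e p - e q\<close> is positive. As norms of points are at most 2,
  distinct points have product at most 1, and product 0 if both norms are 1.\<close>

lemma g_less:
  assumes "p \<in> P" "q \<in> P" "p \<noteq> q"
  shows "2 * g p q < g p p + g q q"
  using pos[of "e p - e q"] assms unit_diff_ne[of p q]
  by (simp add: supp_intros ip_linear ip_unit_unit g_sym[of q p])

lemma g_off01: "p \<in> P \<Longrightarrow> q \<in> P \<Longrightarrow> p \<noteq> q \<Longrightarrow> g p q \<in> {0, 1}"
  using g_less[of p q] g_self_le[of p] g_self_le[of q] g_other[of p q] by auto

lemma short_not_collinear:
  assumes "p \<in> P" "q \<in> P" "p \<noteq> q"
    and "card {l \<in> L. I p l} = D - 1" "card {l \<in> L. I q l} = D - 1"
  shows "g p q = 0"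
  using g_less[of p q] g_off01[of p q] assms D3 by (auto simp: g_self of_nat_diff)

lemma line_unique:
  assumes "p \<in> P" "q \<in> P" "p \<noteq> q" "l \<in> L" "j \<in> L" "I p l" "I q l" "I p j" "I q j"
  shows "l = j"
proof (rule ccontr)
  assume "l \<noteq> j"
  then have "card {l, j} = 2" by simp
  moreover have "card {l, j} \<le> card {l \<in> L. I p l \<and> I q l}"
    using assms finL by (intro card_mono) auto
  ultimately show False using g_off01[OF assms(1-3)] g_other[OF assms(3)] by auto
qed

lemma g_eq_1_iff:
  assumes "p \<in> P" "q \<in> P" "p \<noteq> q"
  shows "g p q = 1 \<longleftrightarrow> (\<exists>l\<in>L. I p l \<and> I q l)"
proof -
  have "g p q = 0 \<longleftrightarrow> \<not> (\<exists>l\<in>L. I p l \<and> I q l)"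
    using finL by (auto simp: g_other[OF assms(3)])
  then show ?thesis using g_off01[OF assms] by auto
qed

text \<open>Double counting of the pairs of a line through \<open>p\<close> and a point on it. If
  all degrees and line sizes are \<open>D\<close>, the value for a point is D^2 - (D - 2).\<close>

lemma sum_codeg:
  "(\<Sum>q\<in>P. g p q) = (\<Sum>l\<in>{l \<in> L. I p l}. int (card (line_pts P I l))) - (if p \<in> P then int D - 2 else 0)"
proof -
  have "(\<Sum>q\<in>P. int (card {l \<in> L. I p l \<and> I q l})) = (\<Sum>q\<in>P. \<Sum>l\<in>L. if I p l \<and> I q l then 1 else 0)"
    using finL by (intro sum.cong) (auto simp: sum.If_cases Int_def)
  also have "\<dots> = (\<Sum>l\<in>L. \<Sum>q\<in>P. if I p l \<and> I q l then 1 else 0)" by (rule sum.swap)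
  also have "\<dots> = (\<Sum>l\<in>L. if I p l then int (card (line_pts P I l)) else 0)"
    using finP by (intro sum.cong) (auto simp: sum.If_cases Int_def line_pts_def)
  also have "\<dots> = (\<Sum>l\<in>{l \<in> L. I p l}. int (card (line_pts P I l)))"
    using finL by (simp add: sum.If_cases Int_def)
  finally show ?thesis
    using finP by (simp add: codeg_form_def sum_subtractf)
qed

lemma card_collinear:
  assumes p: "p \<in> P"
  shows "int (card {q \<in> P. q \<noteq> p \<and> g p q = 1}) + int (card {l \<in> L. I p l})
    = (\<Sum>l\<in>{l \<in> L. I p l}. int (card (line_pts P I l)))"
proof -
  have "(\<Sum>q\<in>P. g p q) = g p p + (\<Sum>q\<in>P - {p}. g p q)"
    using finP p by (rule sum.remove)
  also have "(\<Sum>q\<in>P - {p}. g p q) = (\<Sum>q\<in>{q \<in> P. q \<noteq> p \<and> g p q = 1}. 1)"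
    using finP g_off01[OF p] by (intro sum.mono_neutral_cong_right) auto
  finally show ?thesis using sum_codeg[of p] p by (simp add: g_self)
qed

lemma join_inj:
  assumes x: "x \<in> P" and l: "l \<in> L" "\<not> I x l"
    and col: "\<And>b. b \<in> line_pts P I l \<Longrightarrow> g x b = 1"
  obtains f where "inj_on f (line_pts P I l)"
    "\<And>b. b \<in> line_pts P I l \<Longrightarrow> f b \<in> L \<and> I x (f b) \<and> I b (f b)"
proof (rule join_embedding[of I x l P L])
  show "\<exists>j\<in>L. I x j \<and> I b j" if "b \<in> line_pts P I l" for b
    using g_eq_1_iff[of x b] col[OF that] x that l by (auto simp: line_pts_def)
  show "l = j" if "b \<in> P" "c \<in> P" "b \<noteq> c" "j \<in> L" "I b l" "I c l" "I b j" "I c j" for b c j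
    using line_unique[of b c l j] that l by simp
qed (use l that in auto)

end

section \<open>Regularity from positivity on both sides\<close>

locale dual_incidence =
  pos_incidence P L I D + dual: pos_incidence L P "\<lambda>l p. I p l" D
  for P :: "'a set" and L :: "'b set" and I :: "'a \<Rightarrow> 'b \<Rightarrow> bool" and D :: nat
begin

lemma line_size: "l \<in> L \<Longrightarrow> card (line_pts P I l) \<le> D" "l \<in> L \<Longrightarrow> D - 1 \<le> card (line_pts P I l)"
  using dual.deg_le[of l] dual.deg_ge[of l] by (auto simp: line_pts_def)

text \<open>A point \<open>p\<close> of degree \<open>D - 1\<close> has norm 1. Its collinear points
  \<open>N\<close> then form a clique so closed that every line through \<open>p\<close> missing
  some member of \<open>N\<close> is short, and two such lines meet in \<open>p\<close>, which the
  dual form forbids.\<close>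

lemma deg_eq:
  assumes p: "p \<in> P" shows "card {l \<in> L. I p l} = D"
proof (rule ccontr)
  assume "card {l \<in> L. I p l} \<noteq> D"
  then have degp: "card {l \<in> L. I p l} = D - 1" using deg_le[OF p] deg_ge[OF p] by linarith
  then have gpp: "g p p = 1" using D3 by (simp add: g_self of_nat_diff)
  define N where "N = {q \<in> P. q \<noteq> p \<and> g p q = 1}"
  have degN: "card {l \<in> L. I q l} = D" if "q \<in> N" for q
    using short_not_collinear[of p q] degp that p deg_le[of q] deg_ge[of q]
    by (force simp: N_def)
  then have gqq: "g q q = 2" if "q \<in> N" for q using that by (simp add: g_self)
  \<comment> \<open>For orthogonal \<open>q\<close> and \<open>r\<close> the vector \<open>z\<close>
    has norm 4 + 2 + 2 - 4 - 4 = 0, but its coordinate at \<open>p\<close> is 2.\<close>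
  have clique: "g q r = 1" if "q \<in> N" "r \<in> N" "q \<noteq> r" for q r
  proof (rule ccontr)
    assume "g q r \<noteq> 1"
    then have "g q r = 0" using g_off01[of q r] that by (auto simp: N_def)
    define z where "z = scale_fun 2 (e p) - e q - e r"
    have "ip z z \<le> 0"
      using that p gpp gqq \<open>g q r = 0\<close> g_sym
      by (simp add: z_def ip_linear ip_unit_unit N_def)
    then have "z = 0"
      using that p by (intro not_pos_zero) (auto simp: z_def N_def intro!: supp_intros)
    then have "z p = 0" by simp
    then show False using that by (auto simp: z_def N_def scale_fun_def unit_fun_def split: if_splits)
  qed
  \<comment> \<open>If \<open>z\<close> is not collinear with \<open>p\<close>, the norm of
    \<open>y\<close> is \<open>g z z - 2\<close>, at most 0, but again the coordinate at
    \<open>p\<close> is 2.\<close>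
  have joined: "z \<in> N" if "q \<in> N" "r \<in> N" "q \<noteq> r" "z \<in> P" "z \<noteq> p" "z \<noteq> q" "z \<noteq> r" "g z q = 1" "g z r = 1"
    for q r z
  proof (rule ccontr)
    assume "z \<notin> N"
    then have "g p z = 0" using g_off01[of p z] that p by (auto simp: N_def)
    define y where "y = scale_fun 2 (e p) + e z - e q - e r"
    have "ip y y \<le> 0"
      using that p gpp gqq \<open>g p z = 0\<close> g_sym clique[OF that(1-3)] g_self_le[of z]
      by (simp add: y_def ip_linear ip_unit_unit N_def)
    then have "y = 0"
      using that p by (intro not_pos_zero) (auto simp: y_def N_def intro!: supp_intros)
    then have "y p = 0" by simp
    then show False using that by (auto simp: y_def N_def scale_fun_def unit_fun_def split: if_splits)
  qed
  have finN: "finite N" using finP by (simp add: N_def)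
  have cardN: "int (card N) \<le> (int D - 1) * (int D - 1)"
  proof -
    have "(\<Sum>l\<in>{l \<in> L. I p l}. int (card (line_pts P I l))) \<le> (\<Sum>l\<in>{l \<in> L. I p l}. int D)"
      using line_size by (intro sum_mono) auto
    then show ?thesis
      using card_collinear[OF p] degp D3 by (simp add: N_def of_nat_diff algebra_simps)
  qed
  \<comment> \<open>Short lines do not meet, so at most one of the \<open>D\<close> lines through
    \<open>q\<close> is short and \<open>q\<close> has at least D^2 - D - 1 collinear points. These
    are more than \<open>p\<close> and the rest of \<open>N\<close> can supply.\<close>
  have escape: "\<exists>z\<in>P. z \<noteq> q \<and> g q z = 1 \<and> z \<notin> N \<and> z \<noteq> p" if q: "q \<in> N" for q
  proof (rule ccontr)
    assume "\<not> ?thesis"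
    then have "{z \<in> P. z \<noteq> q \<and> g q z = 1} \<subseteq> insert p (N - {q})" by auto
    then have "card {z \<in> P. z \<noteq> q \<and> g q z = 1} \<le> card (insert p (N - {q}))"
      using finN by (intro card_mono) auto
    also have "\<dots> = card N"
    proof -
      have "p \<notin> N - {q}" by (simp add: N_def)
      then show ?thesis using card_Suc_Diff1[OF finN q] finN by simp
    qed
    finally have "card {z \<in> P. z \<noteq> q \<and> g q z = 1} \<le> card N" .
    moreover have "int D * int D - 1 \<le> (\<Sum>l\<in>{l \<in> L. I q l}. int (card (line_pts P I l)))"
    proof (cases "\<exists>l\<in>L. I q l \<and> card (line_pts P I l) = D - 1")
      case True
      then obtain l where l: "l \<in> L" "I q l" "card (line_pts P I l) = D - 1" by auto
      have big: "card (line_pts P I j) = D" if "j \<in> L" "I q j" "j \<noteq> l" for j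
      proof (rule ccontr)
        assume "card (line_pts P I j) \<noteq> D"
        then have "card (line_pts P I j) = D - 1" using line_size[OF that(1)] by linarith
        then have "dual.g l j = 0"
          using l that by (intro dual.short_not_collinear) (auto simp: line_pts_def)
        then show False using dual.g_eq_1_iff[of l j] l that q by (auto simp: N_def)
      qed
      have "(\<Sum>l\<in>{l \<in> L. I q l}. int (card (line_pts P I l)))
          = int (D - 1) + (\<Sum>j\<in>{l \<in> L. I q l} - {l}. int (card (line_pts P I j)))"
        using finL l by (subst sum.remove[of _ l]) auto
      also have "(\<Sum>j\<in>{l \<in> L. I q l} - {l}. int (card (line_pts P I j))) = (\<Sum>j\<in>{l \<in> L. I q l} - {l}. int D)"
        using big by (intro sum.cong) auto
      also have "\<dots> = (int D - 1) * int D"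
        using degN[OF q] l D3 finL by (simp add: card_Diff_singleton of_nat_diff)
      finally show ?thesis using D3 by (simp add: of_nat_diff algebra_simps)
    next
      case False
      then have "card (line_pts P I l) = D" if "l \<in> L" "I q l" for l
        using line_size[OF that(1)] that D3 by (cases "card (line_pts P I l) = D") force+
      then have "(\<Sum>l\<in>{l \<in> L. I q l}. int (card (line_pts P I l))) = (\<Sum>l\<in>{l \<in> L. I q l}. int D)"
        by (intro sum.cong) auto
      then show ?thesis using degN[OF q] by simp
    qed
    ultimately have "int D * int D - 1 \<le> (int D - 1) * (int D - 1) + int D"
      using card_collinear[of q] cardN degN[OF q] q by (simp add: N_def)
    then show False using D3 by (simp add: algebra_simps)
  qed
  \<comment> \<open>The lines from \<open>q\<close> to the points of \<open>l\<close> are distinct,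
    and the line \<open>j\<close> from \<open>q\<close> to an escaping point \<open>z\<close> is
    none of them: a common point with \<open>l\<close> would make \<open>z\<close> collinear with
    \<open>p\<close> or, by \<open>joined\<close>, a member of \<open>N\<close>. So \<open>q\<close>
    has degree above the size of \<open>l\<close>.\<close>
  have short: "card (line_pts P I l) = D - 1"
    if q: "q \<in> N" and l: "l \<in> L" "I p l" "\<not> I q l" for q l
  proof -
    obtain z where z: "z \<in> P" "z \<noteq> q" "g q z = 1" "z \<notin> N" "z \<noteq> p" using escape[OF q] by auto
    have qP: "q \<in> P" using q by (simp add: N_def)
    obtain j where j: "j \<in> L" "I q j" "I z j" using g_eq_1_iff[OF qP z(1)] z by auto
    have lN: "b \<in> N" if "b \<in> line_pts P I l" "b \<noteq> p" for b
      using that l p g_eq_1_iff[of p b] by (auto simp: N_def line_pts_def)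
    have "g q b = 1" if "b \<in> line_pts P I l" for b
      using clique[OF q lN[OF that]] q that l g_sym[of q p] by (cases "b = p") (auto simp: N_def line_pts_def)
    then obtain f where f: "inj_on f (line_pts P I l)"
      "\<And>b. b \<in> line_pts P I l \<Longrightarrow> f b \<in> L \<and> I q (f b) \<and> I b (f b)"
      using join_inj[OF qP l(1,3)] by blast
    have "j \<notin> f ` line_pts P I l"
    proof
      assume "j \<in> f ` line_pts P I l"
      then obtain b where b: "b \<in> line_pts P I l" "j = f b" by auto
      then have bj: "I b j" "b \<in> P" using f(2) by (auto simp: line_pts_def)
      show False
      proof (cases "b = p")
        case True
        then show False using g_eq_1_iff[of p z] bj j z p by (auto simp: N_def)
      next
        case False
        then have bN: "b \<in> N" using lN b by simp
        have "b \<noteq> q" "b \<noteq> z" using b l bN z by (auto simp: line_pts_def)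
        have "g z q = 1" using z(3) g_sym[of z q] by simp
        moreover have "g z b = 1"
          using g_eq_1_iff[OF z(1) bj(2)] \<open>b \<noteq> z\<close> bj(1) j by blast
        ultimately have "z \<in> N"
          using joined[OF q bN _ z(1)] \<open>b \<noteq> q\<close> \<open>b \<noteq> z\<close> z(2,5) by blast
        then show False using z by simp
      qed
    qed
    then have "card (insert j (f ` line_pts P I l)) = Suc (card (line_pts P I l))"
      using f(1) finP by (simp add: card_image line_pts_def)
    moreover have "card (insert j (f ` line_pts P I l)) \<le> card {l \<in> L. I q l}"
      using f(2) j finL by (intro card_mono) auto
    ultimately show ?thesis using degN[OF q] line_size[OF l(1)] by simp
  qed
  \<comment> \<open>Two lines through \<open>p\<close> each carry a member of \<open>N\<close>
    missing on the other, so both are short.\<close>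
  have "\<not> card {l \<in> L. I p l} \<le> Suc 0" using degp D3 by simp
  then obtain l j where lj: "l \<in> L" "I p l" "j \<in> L" "I p j" "l \<noteq> j"
    using finL by (auto simp: card_le_Suc0_iff_eq)
  have other: "\<exists>q\<in>N. I q l" if "l \<in> L" "I p l" for l
  proof -
    have "\<not> card (line_pts P I l) \<le> Suc 0" using line_size[OF that(1)] D3 by simp
    then obtain q where "q \<in> line_pts P I l" "q \<noteq> p"
      using finP by (auto simp: card_le_Suc0_iff_eq line_pts_def)
    then show ?thesis using g_eq_1_iff[of p q] that p by (auto simp: N_def line_pts_def)
  qed
  obtain q r where qr: "q \<in> N" "I q l" "r \<in> N" "I r j" using other lj by metis
  have "\<not> I q j" "\<not> I r l"
    using qr lj p line_unique[of p q l j] line_unique[of p r l j] by (auto simp: N_def)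
  then have "card (line_pts P I l) = D - 1" "card (line_pts P I j) = D - 1"
    using short qr lj by auto
  then have "dual.g l j = 0"
    using lj by (intro dual.short_not_collinear) (auto simp: line_pts_def)
  then show False using dual.g_eq_1_iff[of l j] lj p by auto
qed

end

section \<open>Regular incidence structures\<close>

locale regular_incidence = pos_incidence +
  assumes deg_eq_D: "p \<in> P \<Longrightarrow> card {l \<in> L. I p l} = D"
    and size_eq_D: "l \<in> L \<Longrightarrow> card (line_pts P I l) = D"
    and fin_rootsP: "finite roots"
    and connP: "p \<in> P \<Longrightarrow> q \<in> P \<Longrightarrow> (\<lambda>x y. x \<in> P \<and> y \<in> P \<and> g x y = 1)\<^sup>*\<^sup>* p q"
    and P_ne: "P \<noteq> {}"
begin

sublocale regular_lattice P g "int D * int D - int D + 2"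
proof
  show "g u u = 2" if "u \<in> P" for u using that by (simp add: g_self deg_eq_D)
  show "(\<Sum>v\<in>P. g u v) = int D * int D - int D + 2" if "u \<in> P" for u
    using that by (subst sum_codeg) (simp add: size_eq_D deg_eq_D)
  have "3 * 2 \<le> int D * (int D - 1)" using D3 by (intro mult_mono) auto
  then show "8 \<le> int D * int D - int D + 2" by (simp add: algebra_simps)
qed (fact fin_rootsP connP P_ne g_off01)+

text \<open>The \<open>D\<close> lines joining \<open>x\<close> to the points of \<open>l\<close>
  are distinct, so they are all the lines through \<open>x\<close>.\<close>

lemma pencil_meets:
  assumes "x \<in> P" "l \<in> L" "\<not> I x l" "\<And>b. b \<in> line_pts P I l \<Longrightarrow> g x b = 1" "j \<in> L" "I x j"
  obtains b where "b \<in> line_pts P I l" "I b j"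
proof -
  obtain f where f: "inj_on f (line_pts P I l)"
      "\<And>b. b \<in> line_pts P I l \<Longrightarrow> f b \<in> L \<and> I x (f b) \<and> I b (f b)"
    using join_inj[OF assms(1-4)] by blast
  have "f ` line_pts P I l = {l \<in> L. I x l}"
    using f finL assms by (intro card_seteq) (auto simp: card_image deg_eq_D size_eq_D)
  then have "j \<in> f ` line_pts P I l" using assms(5,6) by simp
  then obtain b where "b \<in> line_pts P I l" "j = f b" by blast
  then show ?thesis using that f(2) by simp
qed

text \<open>If two pairs of collinear points have different edge moments, their differences are orthogonal. The
  line \<open>l\<close> forces all edges at \<open>x\<close> into the class of \<open>v x\<close>, and orthogonality to \<open>v - y\<close> then makes every
  neighbour of \<open>x\<close> a neighbour of \<open>v\<close>. As both have equally many, \<open>y\<close> would be a neighbour of \<open>x\<close>.\<close>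

lemma one_class_aux:
  assumes V: "v \<in> P" "x \<in> P" "y \<in> P" "z \<in> P"
    and g: "g v x = 1" "g v y = 1" "g x y = 0" "g v z = 1" "g x z = 1"
    and M: "edge_moment v x \<noteq> edge_moment v y" and l: "l \<in> L" "I v l" "I z l" "\<not> I x l"
  shows False
proof -
  have ne: "x \<noteq> y" "v \<noteq> x" "v \<noteq> y" "v \<noteq> z" using M g g_diag V by auto
  have on_l: "g x b = 1 \<and> g v b = 1 \<and> edge_moment v b = edge_moment v x" if b: "b \<in> line_pts P I l" "b \<noteq> v" for b
  proof -
    have bP: "b \<in> P" "I b l" using b by (auto simp: line_pts_def)
    have gvb: "g v b = 1" using g_eq_1_iff[of v b] V bP b l by auto
    have "edge_moment v z = edge_moment v x" using edge_moment_triangle[of v z x] V g g_sym[of x z] by simp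
    moreover have "edge_moment v b = edge_moment v z"
    proof (cases "b = z")
      case False
      then have "g b z = 1" using g_eq_1_iff[of b z] V bP l by auto
      then show ?thesis using edge_moment_triangle[of v b z] V bP gvb g by simp
    qed simp
    ultimately have Mb: "edge_moment v b = edge_moment v x" by simp
    have "b \<noteq> x" "b \<noteq> y" using bP l Mb M by auto
    \<comment> \<open>A triangle \<open>v\<close>, \<open>b\<close>, \<open>y\<close> would equate
      the two edge moments. Hence \<open>b\<close> and \<open>y\<close> are not collinear, and
      \<open>no_claw\<close> makes \<open>x\<close> and \<open>b\<close> collinear.\<close>
    have "g b y \<noteq> 1" using edge_moment_triangle[of v b y] V bP gvb g Mb M by auto
    then have "g b y = 0" using g_off[of b y] V bP \<open>b \<noteq> y\<close> by auto
    then have "g x b \<noteq> 0" using no_claw[of v x y b] V bP g gvb g_sym[of y b] by auto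
    then show ?thesis using g_off[of x b] V bP \<open>b \<noteq> x\<close> gvb Mb by auto
  qed
  have all_col: "g x b = 1" if "b \<in> line_pts P I l" for b
    using on_l[OF that] g g_sym[of x v] by (cases "b = v") auto
  have sub: "insert x {a \<in> P. g x a = 1} \<subseteq> insert v {a \<in> P. g v a = 1}"
  proof (rule insert_subsetI)
    show "x \<in> insert v {a \<in> P. g v a = 1}" using V g by auto
    show "{a \<in> P. g x a = 1} \<subseteq> insert v {a \<in> P. g v a = 1}"
    proof
      fix a assume "a \<in> {a \<in> P. g x a = 1}"
      then have a: "a \<in> P" "g x a = 1" by auto
      then have "a \<noteq> x" using g_diag by auto
      obtain j where j: "j \<in> L" "I x j" "I a j" using g_eq_1_iff[of x a] a V \<open>a \<noteq> x\<close> by auto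
      obtain b where b: "b \<in> line_pts P I l" "I b j"
        using pencil_meets[OF V(2) l(1,4) all_col j(1,2)] by blast
      have bP: "b \<in> P" using b by (simp add: line_pts_def)
      have "g v a = 1 \<or> a = v"
      proof (cases "b = v")
        case True
        then show ?thesis using g_eq_1_iff[of v a] V a b j by auto
      next
        case False
        have "edge_moment x b = edge_moment x v"
          using edge_moment_triangle[of x b v] on_l[OF b(1) False] V bP g g_sym[of x v] g_sym[of b v] by simp
        moreover have "edge_moment x a = edge_moment x b"
        proof (cases "a = b")
          case False
          then have "g a b = 1" using g_eq_1_iff[of a b] a bP b j by auto
          then show ?thesis using edge_moment_triangle[of x a b] a V bP all_col[OF b(1)] by simp
        qed simp
        ultimately have "edge_moment x a \<noteq> edge_moment v y" using M edge_moment_sym by metis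
        \<comment> \<open>Expanded, the orthogonality reads 1 - 0 - g a v + g a y = 0.\<close>
        then have "ip (e x - e a) (e v - e y) = 0"
          using edge_moment_eq[of x a v y] a V g by auto
        then have "g v a = 1 + g a y"
          using a V g g_sym[of x v] g_sym[of a v] by (simp add: ip_linear ip_unit_unit)
        then have "0 < g v a" using g_nonneg[OF a(1) V(3)] by linarith
        then show ?thesis using g_off[of v a] V a by (cases "a = v") auto
      qed
      then show "a \<in> insert v {a \<in> P. g v a = 1}" using a by auto
    qed
  qed
  have card: "card (insert u {a \<in> P. g u a = 1}) = Suc (card {a \<in> P. g u a = 1})" if "u \<in> P" for u
    using finP g_diag[OF that] by simp
  have "card {a \<in> P. g x a = 1} = card {a \<in> P. g v a = 1}"
    using card_nbrs[OF V(1)] card_nbrs[OF V(2)] by simp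
  then have "insert x {a \<in> P. g x a = 1} = insert v {a \<in> P. g v a = 1}"
    using sub finP card[OF V(1)] card[OF V(2)] by (intro card_seteq) auto
  then have "y \<in> insert x {a \<in> P. g x a = 1}" using V g by auto
  then show False using g ne by auto
qed

text \<open>Since \<open>D \<ge> 3\<close>, some line through \<open>v\<close> contains neither
  \<open>x\<close> nor \<open>y\<close>. By \<open>no_claw\<close> a further point \<open>z\<close>
  on it is collinear with \<open>x\<close> or \<open>y\<close>, and \<open>one_class_aux\<close>
  excludes both.\<close>

lemma one_class:
  assumes V: "v \<in> P" "x \<in> P" "y \<in> P" and g: "g v x = 1" "g v y = 1"
  shows "edge_moment v x = edge_moment v y"
proof (rule ccontr)
  assume M: "edge_moment v x \<noteq> edge_moment v y"
  then have ne: "x \<noteq> y" "v \<noteq> x" "v \<noteq> y" using g g_diag V by auto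
  have "g x y \<noteq> 1" using edge_moment_triangle[of v x y] M V g by auto
  then have gxy: "g x y = 0" using g_off[of x y] V ne by auto
  obtain i where i: "i \<in> L" "I v i" "I x i" using g_eq_1_iff[of v x] V g ne by auto
  obtain j where j: "j \<in> L" "I v j" "I y j" using g_eq_1_iff[of v y] V g ne by auto
  have "card {i, j} < card {l \<in> L. I v l}"
    using deg_eq_D[OF V(1)] D3 by (simp add: card_insert_if)
  then have "\<not> {l \<in> L. I v l} \<subseteq> {i, j}" by (meson card_mono finite.emptyI finite.insertI not_le)
  then obtain l where l: "l \<in> L" "I v l" "l \<noteq> i" "l \<noteq> j" by auto
  have "\<not> card (line_pts P I l) \<le> Suc 0" using size_eq_D[OF l(1)] D3 by simp
  then obtain z where z: "z \<in> P" "I z l" "z \<noteq> v"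
    using finP by (auto simp: card_le_Suc0_iff_eq line_pts_def)
  have nx: "\<not> I x l" "\<not> I y l"
    using line_unique[of v x l i] line_unique[of v y l j] V i j l ne by auto
  have gvz: "g v z = 1" using g_eq_1_iff[of v z] V z l by auto
  have zz: "z \<noteq> x" "z \<noteq> y" using nx z by auto
  have "g x z \<noteq> 0 \<or> g y z \<noteq> 0" using no_claw[of v x y z] V z g gvz gxy by auto
  then show False
  proof
    assume "g x z \<noteq> 0"
    then have "g x z = 1" using g_off[of x z] V z zz by auto
    then show False using one_class_aux[of v x y z l] V z g gxy gvz M l nx by auto
  next
    assume "g y z \<noteq> 0"
    then have "g y z = 1" using g_off[of y z] V z zz by auto
    then show False using one_class_aux[of v y x z l] V z g gxy g_sym[of x y] gvz M l nx by auto
  qed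
qed

text \<open>Two further points on each of two lines through \<open>v\<close>: any third line
  contains at most one point of each pair.\<close>

lemma quadrangle:
  obtains F where "F \<subseteq> P" "card F = 4" "\<And>k. k \<in> L \<Longrightarrow> card {p \<in> F. I p k} \<le> 2"
proof -
  obtain v where v: "v \<in> P" using P_ne by auto
  have "\<not> card {l \<in> L. I v l} \<le> Suc 0" using deg_eq_D[OF v] D3 by simp
  then obtain l j where lj: "l \<in> L" "I v l" "j \<in> L" "I v j" "l \<noteq> j"
    using finL by (auto simp: card_le_Suc0_iff_eq)
  have two: "\<exists>a b. a \<in> P \<and> b \<in> P \<and> a \<noteq> b \<and> a \<noteq> v \<and> b \<noteq> v \<and> I a l \<and> I b l"
    if l: "l \<in> L" "I v l" for l
  proof -
    have "card (line_pts P I l - {v}) = D - 1"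
      using size_eq_D[OF l(1)] v l finP by (simp add: line_pts_def)
    then have "\<not> card (line_pts P I l - {v}) \<le> Suc 0" using D3 by simp
    then show ?thesis using finP by (auto simp: card_le_Suc0_iff_eq line_pts_def)
  qed
  obtain a b where ab: "a \<in> P" "b \<in> P" "a \<noteq> b" "a \<noteq> v" "b \<noteq> v" "I a l" "I b l"
    using two[OF lj(1,2)] by auto
  obtain c d where cd: "c \<in> P" "d \<in> P" "c \<noteq> d" "c \<noteq> v" "d \<noteq> v" "I c j" "I d j"
    using two[OF lj(3,4)] by auto
  have off: "\<not> I a j" "\<not> I b j" "\<not> I c l" "\<not> I d l"
    using line_unique[of v a l j] line_unique[of v b l j] line_unique[of v c l j]
      line_unique[of v d l j] v lj ab cd by auto
  then have ne: "a \<noteq> c" "a \<noteq> d" "b \<noteq> c" "b \<noteq> d" using cd by auto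
  show ?thesis
  proof
    show "{a, b, c, d} \<subseteq> P" using ab cd by auto
    show "card {a, b, c, d} = 4" using ne ab(3) cd(3) by simp
    fix k assume k: "k \<in> L"
    consider "k = l" | "k = j" | "k \<noteq> l" "k \<noteq> j" by auto
    then show "card {p \<in> {a, b, c, d}. I p k} \<le> 2"
    proof cases
      case 1
      then have "{p \<in> {a, b, c, d}. I p k} \<subseteq> {a, b}" using off by auto
      from card_mono[OF _ this] show ?thesis using ab(3) by simp
    next
      case 2
      then have "{p \<in> {a, b, c, d}. I p k} \<subseteq> {c, d}" using off by auto
      from card_mono[OF _ this] show ?thesis using cd(3) by simp
    next
      case 3
      have "\<not> (I a k \<and> I b k)" "\<not> (I c k \<and> I d k)"
        using line_unique[of a b l k] line_unique[of c d j k] ab cd lj k 3 by auto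
      then have "\<exists>x y. {p \<in> {a, b, c, d}. I p k} \<subseteq> {x, y}" by blast
      then obtain x y where "{p \<in> {a, b, c, d}. I p k} \<subseteq> {x, y}" by blast
      from card_mono[OF _ this] have "card {p \<in> {a, b, c, d}. I p k} \<le> card {x, y}" by simp
      also have "\<dots> \<le> 2" by (simp add: card_insert_if)
      finally show ?thesis .
    qed
  qed
qed

lemma all_collinear: "x \<in> P \<Longrightarrow> y \<in> P \<Longrightarrow> x \<noteq> y \<Longrightarrow> \<exists>l\<in>L. I x l \<and> I y l"
  using complete[OF one_class] g_eq_1_iff by blast

end

section \<open>The form of a bipartite graph\<close>

lemma gram_codeg_form:
  assumes "finite P" "finite L"
  shows "gram_form P (codeg_form L I D) x x =
    (\<Sum>l\<in>L. (\<Sum>p\<in>P. if I p l then x p else 0)\<^sup>2) - (int D - 2) * (\<Sum>p\<in>P. (x p)\<^sup>2)"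
proof -
  have c: "int (card {l \<in> L. I p l \<and> I q l}) = (\<Sum>l\<in>L. of_bool (I p l) * of_bool (I q l))" for p q
    using assms by (simp add: of_bool_conj[symmetric] Int_def flip: of_bool_conj)
  have "(\<Sum>p\<in>P. \<Sum>q\<in>P. x p * x q * int (card {l \<in> L. I p l \<and> I q l}))
      = (\<Sum>p\<in>P. \<Sum>l\<in>L. \<Sum>q\<in>P. (of_bool (I p l) * x p) * (of_bool (I q l) * x q))"
    unfolding c sum_distrib_left
    by (rule sum.cong[OF refl], subst sum.swap) (simp add: mult_ac)
  also have "\<dots> = (\<Sum>l\<in>L. \<Sum>p\<in>P. \<Sum>q\<in>P. (of_bool (I p l) * x p) * (of_bool (I q l) * x q))"
    by (rule sum.swap)
  also have "\<dots> = (\<Sum>l\<in>L. (\<Sum>p\<in>P. of_bool (I p l) * x p)\<^sup>2)"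
    by (simp add: power2_eq_square sum_product)
  also have "\<dots> = (\<Sum>l\<in>L. (\<Sum>p\<in>P. if I p l then x p else 0)\<^sup>2)"
    by (intro sum.cong arg_cong[of _ _ "\<lambda>a. a\<^sup>2"] refl) auto
  finally have 1: "(\<Sum>p\<in>P. \<Sum>q\<in>P. x p * x q * int (card {l \<in> L. I p l \<and> I q l}))
      = (\<Sum>l\<in>L. (\<Sum>p\<in>P. if I p l then x p else 0)\<^sup>2)" .
  have 2: "(\<Sum>q\<in>P. x p * x q * (if p = q then int D - 2 else 0)) = (int D - 2) * (x p)\<^sup>2"
    if "p \<in> P" for p
    using assms that by (simp add: if_distrib[of "\<lambda>a. _ * a"] power2_eq_square cong: if_cong)
  have "gram_form P (codeg_form L I D) x x =
      (\<Sum>p\<in>P. \<Sum>q\<in>P. x p * x q * int (card {l \<in> L. I p l \<and> I q l}))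
      - (\<Sum>p\<in>P. \<Sum>q\<in>P. x p * x q * (if p = q then int D - 2 else 0))"
    by (simp only: gram_form_def codeg_form_def right_diff_distrib sum_subtractf)
  then show ?thesis by (simp add: 1 2 sum_distrib_left)
qed

text \<open>The adjacency matrix maps vectors supported on \<open>P\<close> to vectors supported on
  \<open>L\<close>, so the integral form is A^2 - (D - 2) I restricted to one class.\<close>

lemma gram_codeg_form_matrix:
  fixes a :: "nat \<Rightarrow> nat \<Rightarrow> real"
  assumes PL: "P \<union> L = {..<n}" "P \<inter> L = {}"
    and a1: "\<And>p l. p \<in> P \<Longrightarrow> l \<in> L \<Longrightarrow> a l p = (if I p l then 1 else 0)"
    and a0: "\<And>p q. p \<in> P \<Longrightarrow> q \<in> P \<Longrightarrow> a p q = 0"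
    and x: "x \<in> supp_in P"
  shows "real_of_int (gram_form P (codeg_form L I D) x x) =
    (\<Sum>i<n. (\<Sum>j<n. a i j * real_of_int (x j))\<^sup>2) - (real D - 2) * (\<Sum>i<n. (real_of_int (x i))\<^sup>2)"
proof -
  have fin: "finite P" "finite L" using PL by (metis finite_Un finite_lessThan)+
  have inner: "(\<Sum>j<n. a i j * real_of_int (x j)) = (\<Sum>p\<in>P. a i p * real_of_int (x p))" for i
    using x PL by (intro sum.mono_neutral_right) (auto simp: supp_in_def)
  have zero: "(\<Sum>p\<in>P. a i p * real_of_int (x p)) = 0" if "i \<in> {..<n} - L" for i
  proof -
    have "i \<in> P" using that PL(1) by auto
    then show ?thesis using a0 by simp
  qed
  have "L \<subseteq> {..<n}" using PL(1) by auto
  then have "(\<Sum>i<n. (\<Sum>j<n. a i j * real_of_int (x j))\<^sup>2)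
      = (\<Sum>l\<in>L. (\<Sum>p\<in>P. a l p * real_of_int (x p))\<^sup>2)"
    unfolding inner using zero by (intro sum.mono_neutral_right) auto
  also have "\<dots> = (\<Sum>l\<in>L. (real_of_int (\<Sum>p\<in>P. if I p l then x p else 0))\<^sup>2)"
    using a1 by (intro sum.cong arg_cong[of _ _ "\<lambda>a. a\<^sup>2"] refl) (auto simp: of_int_sum intro!: sum.cong)
  finally have 1: "(\<Sum>i<n. (\<Sum>j<n. a i j * real_of_int (x j))\<^sup>2)
      = (\<Sum>l\<in>L. (real_of_int (\<Sum>p\<in>P. if I p l then x p else 0))\<^sup>2)" .
  have 2: "(\<Sum>i<n. (real_of_int (x i))\<^sup>2) = (\<Sum>p\<in>P. (real_of_int (x p))\<^sup>2)"
    using x PL by (intro sum.mono_neutral_right) (auto simp: supp_in_def)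
  show ?thesis unfolding gram_codeg_form[OF fin] 1 2 by simp
qed

text \<open>The margin \<epsilon> gives definiteness and also bounds the sum of squares of a root,
  whose integer coordinates then lie in a finite box.\<close>

lemma coercive_form:
  assumes fin: "finite P" and \<epsilon>: "0 < \<epsilon>"
    and coercive: "\<And>x. x \<in> supp_in P \<Longrightarrow>
      \<epsilon> * (\<Sum>p\<in>P. (real_of_int (x p))\<^sup>2) \<le> real_of_int (gram_form P h x x)"
  shows "x \<in> supp_in P \<Longrightarrow> x \<noteq> 0 \<Longrightarrow> 0 < gram_form P h x x"
    and "finite {x \<in> supp_in P. gram_form P h x x = 2}"
proof -
  assume x: "x \<in> supp_in P" "x \<noteq> 0"
  then obtain p where "p \<in> P" "x p \<noteq> 0" by (auto simp: supp_in_def fun_eq_iff)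
  then have "0 < (\<Sum>p\<in>P. (real_of_int (x p))\<^sup>2)"
    using fin by (intro sum_pos2[of _ p]) auto
  then have "0 < \<epsilon> * (\<Sum>p\<in>P. (real_of_int (x p))\<^sup>2)" using \<epsilon> by simp
  then show "0 < gram_form P h x x" using coercive[OF x(1)] by linarith
next
  define N where "N = \<lceil>2 / \<epsilon>\<rceil>"
  have bound: "x p \<in> {-N..N}" if "x \<in> supp_in P" "gram_form P h x x = 2" "p \<in> P" for x p
  proof -
    have "(real_of_int (x p))\<^sup>2 \<le> (\<Sum>p\<in>P. (real_of_int (x p))\<^sup>2)"
      using fin that by (intro member_le_sum) auto
    also have "\<dots> \<le> 2 / \<epsilon>" using coercive[OF that(1)] that(2) \<epsilon> by (simp add: field_simps)
    also have "\<dots> \<le> real_of_int N" by (simp add: N_def)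
    finally have "(x p)\<^sup>2 \<le> N" by (simp only: of_int_le_iff flip: of_int_power)
    moreover have "\<bar>x p\<bar> \<le> (x p)\<^sup>2"
    proof (cases "x p = 0")
      case False
      then show ?thesis
        using mult_left_mono[of 1 "\<bar>x p\<bar>" "\<bar>x p\<bar>"] by (simp add: power2_eq_square)
    qed simp
    ultimately show ?thesis by auto
  qed
  have "finite {x. \<forall>p. (p \<in> P \<longrightarrow> x p \<in> {-N..N}) \<and> (p \<notin> P \<longrightarrow> x p = 0)}"
    using fin by (intro finite_set_of_finite_funs) auto
  then show "finite {x \<in> supp_in P. gram_form P h x x = 2}"
    by (rule finite_subset[rotated]) (use bound in \<open>auto simp: supp_in_def\<close>)
qed

text \<open>A walk alternates between the classes. The induction is strengthened to remember, while
  at a vertex of \<open>L\<close>, a neighbour in \<open>P\<close> already reached by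
  \<open>R\<close>.\<close>

lemma bipartite_walk:
  assumes walk: "(\<lambda>x y. x < n \<and> y < n \<and> E x y)\<^sup>*\<^sup>* p v" and p: "p \<in> P"
    and PL: "P \<union> L = {..<n}"
    and cross: "\<And>u v. u < n \<Longrightarrow> v < n \<Longrightarrow> E u v \<Longrightarrow> (u \<in> P \<and> v \<in> L) \<or> (u \<in> L \<and> v \<in> P)"
    and disj: "P \<inter> L = {}"
    and R: "\<And>x y l. x \<in> P \<Longrightarrow> y \<in> P \<Longrightarrow> x \<noteq> y \<Longrightarrow> l \<in> L \<Longrightarrow> E x l \<Longrightarrow> E l y \<Longrightarrow> R x y"
  shows "v \<in> P \<Longrightarrow> R\<^sup>*\<^sup>* p v"
proof -
  have "(v \<in> P \<longrightarrow> R\<^sup>*\<^sup>* p v) \<and> (v \<in> L \<longrightarrow> (\<exists>q\<in>P. R\<^sup>*\<^sup>* p q \<and> E q v))"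
    using walk
  proof (induction rule: rtranclp_induct)
    case base
    then show ?case using p disj by auto
  next
    case (step y z)
    then have yz: "y < n" "z < n" "E y z" by auto
    from cross[OF yz] show ?case
    proof
      assume "y \<in> P \<and> z \<in> L"
      then show ?thesis using step.IH yz disj by blast
    next
      assume yz': "y \<in> L \<and> z \<in> P"
      then obtain q where q: "q \<in> P" "R\<^sup>*\<^sup>* p q" "E q y" using step.IH by auto
      have "R\<^sup>*\<^sup>* p z"
      proof (cases "q = z")
        case False
        then have "R q z" using R[OF q(1)] q(3) yz yz' by auto
        then show ?thesis using q(2) by simp
      qed (use q in simp)
      then show ?thesis using yz' disj by auto
    qed
  qed
  then show "v \<in> P \<Longrightarrow> R\<^sup>*\<^sup>* p v" by blast
qed

lemma degree_le_max:
  assumes "u < n" shows "degree n E u \<le> max_degree n E"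
  unfolding max_degree_def using assms by (intro Max_ge) auto

lemma adj_matrix_coercive:
  assumes simple: "simple_graph n E" and bip: "bipartite_graph n E" and n: "0 < n"
    and c: "0 \<le> c" "c < HL_index n E"
  obtains m where "c\<^sup>2 < m" "\<And>x :: nat \<Rightarrow> real.
    m * (\<Sum>i<n. (x i)\<^sup>2) \<le> (\<Sum>i<n. (\<Sum>j<n. of_bool (i < n \<and> j < n \<and> E i j) * x j)\<^sup>2)"
proof -
  \<comment> \<open>The index bounds make \<open>a\<close> symmetric on all natural numbers, as
    \<open>symmetric_square_coercive\<close> demands.\<close>
  define a where "a = (\<lambda>i j. of_bool (i < n \<and> j < n \<and> E i j) :: real)"
  have adj: "adj_matrix n E = mat n n (\<lambda>(i, j). a i j)"
    by (rule eq_matI) (auto simp: adj_matrix_def a_def)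
  have sym: "a i j = a j i" for i j
    using simple by (auto simp: a_def simple_graph_def)
  have "c < \<bar>\<mu>\<bar>" if "eigenvalue (mat n n (\<lambda>(i, j). a i j)) \<mu>" for \<mu>
    using HL_index_eigenvalue(2)[OF simple bip n] that c(2) by (fastforce simp: adj)
  then obtain m where "c\<^sup>2 < m" "\<And>x. m * (\<Sum>i<n. (x i)\<^sup>2) \<le> (\<Sum>i<n. (\<Sum>j<n. a i j * x j)\<^sup>2)"
    using symmetric_square_coercive[of a c n, OF sym c(1) n] by blast
  then show ?thesis using that unfolding a_def by blast
qed

definition bipartition :: "nat \<Rightarrow> (nat \<Rightarrow> nat \<Rightarrow> bool) \<Rightarrow> nat set \<Rightarrow> nat set \<Rightarrow> bool" where
  "bipartition n E P L \<longleftrightarrow> P \<union> L = {..<n} \<and> P \<inter> L = {} \<and>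
     (\<forall>u<n. \<forall>v<n. E u v \<longrightarrow> (u \<in> P \<and> v \<in> L) \<or> (u \<in> L \<and> v \<in> P))"

lemma bipartition_sym: "bipartition n E P L \<Longrightarrow> bipartition n E L P"
  unfolding bipartition_def by (simp add: Un_commute Int_commute disj_commute)

lemma bipartition_neighbours:
  assumes "bipartition n E P L" "p \<in> P" shows "{l \<in> L. E p l} = {v. v < n \<and> E p v}"
  using assms unfolding bipartition_def by auto

text \<open>\<open>I\<close> is tied to \<open>E\<close> only between \<open>P\<close> and
  \<open>L\<close>, so that the result also serves the other class with the transposed
  relation.\<close>

lemma coercive_imp_pos_incidence:
  assumes part: "bipartition n E P L" and simple: "simple_graph n E"
    and D3: "3 \<le> max_degree n E"
    and m: "real (max_degree n E) - 2 < m" "\<And>x :: nat \<Rightarrow> real.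
      m * (\<Sum>i<n. (x i)\<^sup>2) \<le> (\<Sum>i<n. (\<Sum>j<n. of_bool (i < n \<and> j < n \<and> E i j) * x j)\<^sup>2)"
    and I: "\<And>p l. p \<in> P \<Longrightarrow> l \<in> L \<Longrightarrow> I p l = E p l"
  shows "pos_incidence P L I (max_degree n E)"
    and "finite (pos_lattice.roots P (codeg_form L I (max_degree n E)))"
proof -
  let ?D = "max_degree n E"
  have PL: "P \<union> L = {..<n}" "P \<inter> L = {}"
    and cross: "\<And>u v. u < n \<Longrightarrow> v < n \<Longrightarrow> E u v \<Longrightarrow> (u \<in> P \<and> v \<in> L) \<or> (u \<in> L \<and> v \<in> P)"
    using part unfolding bipartition_def by blast+
  have sym: "E u v = E v u" if "u < n" "v < n" for u v
    using simple that by (simp add: simple_graph_def)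
  have fin: "finite P" "finite L" using PL(1) by (metis finite_Un finite_lessThan)+
  have lt: "p \<in> P \<Longrightarrow> p < n" "l \<in> L \<Longrightarrow> l < n" for p l using PL(1) by auto
  define a where "a = (\<lambda>i j. of_bool (i < n \<and> j < n \<and> E i j) :: real)"
  have form: "real_of_int (gram_form P (codeg_form L I ?D) x x) =
      (\<Sum>i<n. (\<Sum>j<n. a i j * real_of_int (x j))\<^sup>2) - (real ?D - 2) * (\<Sum>i<n. (real_of_int (x i))\<^sup>2)"
    if "x \<in> supp_in P" for x
  proof (rule gram_codeg_form_matrix[OF PL _ _ that])
    show "a l p = (if I p l then 1 else 0)" if "p \<in> P" "l \<in> L" for p l
      using that lt I[OF that] sym[of l p] by (simp add: a_def)
    show "a p q = 0" if "p \<in> P" "q \<in> P" for p q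
      using cross[of p q] lt that PL(2) by (auto simp: a_def)
  qed
  have coercive: "(m - (real ?D - 2)) * (\<Sum>p\<in>P. (real_of_int (x p))\<^sup>2)
      \<le> real_of_int (gram_form P (codeg_form L I ?D) x x)" if x: "x \<in> supp_in P" for x
  proof -
    have "(\<Sum>i<n. (real_of_int (x i))\<^sup>2) = (\<Sum>p\<in>P. (real_of_int (x p))\<^sup>2)"
      using x PL(1) by (intro sum.mono_neutral_right) (auto simp: supp_in_def)
    then show ?thesis
      using m(2)[of "\<lambda>i. real_of_int (x i)"] form[OF x] by (simp add: a_def algebra_simps)
  qed
  have "0 < m - (real ?D - 2)" using m(1) by simp
  note pd = coercive_form[OF fin(1) this coercive]
  show inc: "pos_incidence P L I ?D"
  proof
    show "card {l \<in> L. I p l} \<le> ?D" if "p \<in> P" for p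
    proof -
      have "{l \<in> L. I p l} = {v. v < n \<and> E p v}"
        using bipartition_neighbours[OF part that] I that by auto
      then show ?thesis using degree_le_max[of p n E] lt that by (simp add: degree_def)
    qed
  qed (use fin D3 pd in auto)
  then interpret pos_incidence P L I ?D .
  show "finite roots" using pd(2) by (simp add: roots_def)
qed

section \<open>A large HL-index forces a projective plane\<close>

lemma large_HL_imp_plane:
  assumes simple: "simple_graph n E" and conn: "connected_graph n E" and bip: "bipartite_graph n E"
    and D3: "3 \<le> max_degree n E"
    and large: "sqrt (real (max_degree n E) - 2) < HL_index n E"
  shows "is_PP_incidence_graph n E (max_degree n E - 1)"
proof -
  define D where "D = max_degree n E"
  have n: "0 < n" using conn by (simp add: connected_graph_def)
  have sym: "E u v = E v u" if "u < n" "v < n" for u v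
    using simple that by (simp add: simple_graph_def)
  have s0: "0 \<le> sqrt (real D - 2)" using D3 by (simp add: D_def)
  obtain m where m: "(sqrt (real D - 2))\<^sup>2 < m" "\<And>x :: nat \<Rightarrow> real.
      m * (\<Sum>i<n. (x i)\<^sup>2) \<le> (\<Sum>i<n. (\<Sum>j<n. of_bool (i < n \<and> j < n \<and> E i j) * x j)\<^sup>2)"
    using adj_matrix_coercive[OF simple bip n s0] large unfolding D_def by blast
  have m1: "real (max_degree n E) - 2 < m" using m(1) D3 by (simp add: D_def)
  obtain col :: "nat \<Rightarrow> bool" where "\<forall>u<n. \<forall>v<n. E u v \<longrightarrow> col u \<noteq> col v"
    using bip unfolding bipartite_graph_def by blast
  then have col: "col u \<noteq> col v" if "u < n" "v < n" "E u v" for u v using that by blast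
  define P where "P = {u. u < n \<and> col u}"
  define L where "L = {u. u < n \<and> \<not> col u}"
  have part: "bipartition n E P L"
    using col unfolding bipartition_def P_def L_def by fastforce
  then have part': "bipartition n E L P" by (rule bipartition_sym)
  have lt: "p \<in> P \<Longrightarrow> p < n" "l \<in> L \<Longrightarrow> l < n" for p l by (auto simp: P_def L_def)
  have EI: "l \<in> L \<Longrightarrow> p \<in> P \<Longrightarrow> E p l = E l p" for l p using sym lt by simp
  have inc: "pos_incidence P L E D" "finite (pos_lattice.roots P (codeg_form L E D))"
    using coercive_imp_pos_incidence[OF part simple D3 m1 m(2), of E] by (simp_all add: D_def)
  have inc': "pos_incidence L P (\<lambda>l p. E p l) D"
    "finite (pos_lattice.roots L (codeg_form P (\<lambda>l p. E p l) D))"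
    using coercive_imp_pos_incidence[OF part' simple D3 m1 m(2), of "\<lambda>l p. E p l"] EI
    by (simp_all add: D_def)
  \<comment> \<open>Both classes satisfy the same hypotheses: \<open>A\<close> yields the degrees of
    the points and \<open>B\<close> the sizes of the lines.\<close>
  interpret A: dual_incidence P L E D using inc(1) inc'(1) by (rule dual_incidence.intro)
  interpret B: dual_incidence L P "\<lambda>l p. E p l" D using inc'(1) inc(1) by (rule dual_incidence.intro)
  have walk: "(\<lambda>x y. x < n \<and> y < n \<and> E x y)\<^sup>*\<^sup>* u v" if "u < n" "v < n" for u v
    using conn that by (simp add: connected_graph_def)
  \<comment> \<open>A vertex of maximum degree has a neighbour, so neither class is empty.\<close>
  have "\<exists>u<n. 3 \<le> degree n E u"
  proof -
    have "max_degree n E \<in> degree n E ` {0..<n}"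
      unfolding max_degree_def using n by (intro Max_in) auto
    then show ?thesis using D3 by auto
  qed
  then obtain u where u: "u < n" "3 \<le> degree n E u" by blast
  have "{v. v < n \<and> E u v} \<noteq> {}"
  proof
    assume "{v. v < n \<and> E u v} = {}"
    then show False using u(2) unfolding degree_def by (metis card.empty not_numeral_le_zero)
  qed
  then obtain v where v: "v < n" "E u v" by auto
  have ne: "P \<noteq> {}" "L \<noteq> {}" using col[OF u(1) v] u v by (auto simp: P_def L_def)
  have size: "card (line_pts P E l) = D" if "l \<in> L" for l
    using B.deg_eq[OF that] by (simp add: line_pts_def)
  have size': "card (line_pts L (\<lambda>l p. E p l) p) = D" if "p \<in> P" for p
    using A.deg_eq[OF that] by (simp add: line_pts_def)
  interpret R: regular_incidence P L E D
  proof
    show "(\<lambda>x y. x \<in> P \<and> y \<in> P \<and> A.g x y = 1)\<^sup>*\<^sup>* p q" if "p \<in> P" "q \<in> P" for p q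
    proof (rule bipartite_walk[OF walk that(1) _ _ _ _ that(2)])
      show "x \<in> P \<and> y \<in> P \<and> A.g x y = 1" if "x \<in> P" "y \<in> P" "x \<noteq> y" "l \<in> L" "E x l" "E l y" for x y l
        using that A.g_eq_1_iff[of x y] EI by blast
    qed (use part lt that in \<open>auto simp: bipartition_def\<close>)
  qed (use A.deg_eq size inc(2) ne in auto)
  interpret S: regular_incidence L P "\<lambda>l p. E p l" D
  proof
    show "(\<lambda>x y. x \<in> L \<and> y \<in> L \<and> A.dual.g x y = 1)\<^sup>*\<^sup>* p q" if "p \<in> L" "q \<in> L" for p q
    proof (rule bipartite_walk[OF walk that(1) _ _ _ _ that(2)])
      show "x \<in> L \<and> y \<in> L \<and> A.dual.g x y = 1" if "x \<in> L" "y \<in> L" "x \<noteq> y" "l \<in> P" "E x l" "E l y" for x y l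
        using that A.dual.g_eq_1_iff[of x y] EI by blast
    qed (use part' lt that in \<open>auto simp: bipartition_def\<close>)
  qed (use B.deg_eq size' inc'(2) ne in auto)
  have "projective_plane_of_order P L E (D - 1)"
    unfolding projective_plane_of_order_def
  proof (intro conjI ballI impI)
    fix p q assume pq: "p \<in> P" "q \<in> P" "p \<noteq> q"
    then show "\<exists>!l. l \<in> L \<and> E p l \<and> E q l"
      using R.all_collinear[OF pq] A.line_unique[OF pq] by blast
  next
    fix l j assume lj: "l \<in> L" "j \<in> L" "l \<noteq> j"
    then show "\<exists>!p. p \<in> P \<and> E p l \<and> E p j"
      using S.all_collinear[OF lj] A.dual.line_unique[OF lj] by blast
  next
    obtain F where "F \<subseteq> P" "card F = 4" "\<And>k. k \<in> L \<Longrightarrow> card {p \<in> F. E p k} \<le> 2"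
      using R.quadrangle by blast
    then show "\<exists>F\<subseteq>P. card F = 4 \<and> (\<forall>l\<in>L. card {p \<in> F. E p l} \<le> 2)" by blast
  next
    fix l assume "l \<in> L"
    then show "card {p \<in> P. E p l} = D - 1 + 1"
      using size[of l] D3 by (simp add: line_pts_def D_def)
  qed
  moreover have "P \<union> L = {0..<n}" by (auto simp: P_def L_def)
  ultimately show ?thesis
    using part unfolding is_PP_incidence_graph_def bipartition_def D_def by blast
qed

section \<open>The HL-index of the incidence graph of a projective plane\<close>

lemma plane_degree:
  assumes plane: "projective_plane_of_order P L I q" and p: "p \<in> P" and fin: "finite L"
  shows "q + 1 \<le> card {l \<in> L. I p l}"
proof -
  have join: "\<exists>!l. l \<in> L \<and> I a l \<and> I b l" if "a \<in> P" "b \<in> P" "a \<noteq> b" for a b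
    using plane that unfolding projective_plane_of_order_def by blast
  have size: "card (line_pts P I l) = q + 1" if "l \<in> L" for l
    using plane that unfolding projective_plane_of_order_def line_pts_def by blast
  have "\<exists>F\<subseteq>P. card F = 4 \<and> (\<forall>l\<in>L. card {x \<in> F. I x l} \<le> 2)"
    using plane unfolding projective_plane_of_order_def by (elim conjE)
  then obtain F where F: "F \<subseteq> P" "card F = 4" "\<And>l. l \<in> L \<Longrightarrow> card {x \<in> F. I x l} \<le> 2"
    by blast
  have finF: "finite F" using F(2) by (metis card.infinite zero_neq_numeral)
  \<comment> \<open>If all lines passed through \<open>p\<close>, take three points of
    \<open>F\<close> other than \<open>p\<close>. The lines from \<open>a\<close> to
    \<open>b\<close> and to \<open>c\<close> both join \<open>a\<close> and \<open>p\<close>, so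
    they coincide and contain three points of \<open>F\<close>.\<close>
  have "\<exists>l\<in>L. \<not> I p l"
  proof (rule ccontr)
    assume "\<not> ?thesis"
    then have all: "I p l" if "l \<in> L" for l using that by blast
    have "\<not> card (F - {p}) \<le> Suc 0" using F(2) finF by (simp add: card_Diff_singleton_if)
    then obtain a b where ab: "a \<in> F" "b \<in> F" "a \<noteq> b" "a \<noteq> p" "b \<noteq> p"
      using finF by (auto simp: card_le_Suc0_iff_eq)
    have "\<not> F \<subseteq> {a, b, p}"
    proof
      assume "F \<subseteq> {a, b, p}"
      then have "card F \<le> card {a, b, p}" by (intro card_mono) auto
      then show False using F(2) by (simp add: card_insert_if split: if_splits)
    qed
    then obtain c where c: "c \<in> F" "c \<noteq> a" "c \<noteq> b" "c \<noteq> p" by auto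
    obtain k where k: "k \<in> L" "I a k" "I b k" using join[of a b] ab F(1) by blast
    obtain j where j: "j \<in> L" "I a j" "I c j" using join[of a c] ab c F(1) by blast
    have "j = k" using join[of a p] ab F(1) p k j all by blast
    then have "{a, b, c} \<subseteq> {x \<in> F. I x k}" using ab c k j by auto
    then have "card {a, b, c} \<le> card {x \<in> F. I x k}" using finF by (intro card_mono) auto
    moreover have "card {a, b, c} = 3" using ab c by simp
    ultimately show False using F(3)[OF k(1)] by simp
  qed
  then obtain l where l: "l \<in> L" "\<not> I p l" by blast
  obtain f where f: "inj_on f (line_pts P I l)"
    "\<And>b. b \<in> line_pts P I l \<Longrightarrow> f b \<in> L \<and> I p (f b) \<and> I b (f b)"
  proof (rule join_embedding[of I p l P L])
    show "\<exists>j\<in>L. I p j \<and> I b j" if "b \<in> line_pts P I l" for b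
    proof -
      have "b \<in> P" "p \<noteq> b" using that l by (auto simp: line_pts_def)
      then show ?thesis using join[OF p] by blast
    qed
    show "l = j" if "b \<in> P" "c \<in> P" "b \<noteq> c" "j \<in> L" "I b l" "I c l" "I b j" "I c j" for b c j
      using join[OF that(1-3)] that l by blast
  qed (use l in auto)
  have "card (f ` line_pts P I l) \<le> card {l \<in> L. I p l}"
    using f(2) fin by (intro card_mono) auto
  then show ?thesis using f(1) size[OF l(1)] by (simp add: card_image)
qed

text \<open>Row \<open>p\<close> of N N^T = (D - 1) I + J, with J the all-ones matrix: a point
  shares \<open>D\<close> lines with itself and one with any other point.\<close>

lemma join_operator:
  fixes x :: "'a \<Rightarrow> real"
  assumes fin: "finite P" "finite L" and p: "p \<in> P" and deg: "card {l \<in> L. I p l} = D"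
    and join: "\<And>q. q \<in> P \<Longrightarrow> p \<noteq> q \<Longrightarrow> \<exists>!l. l \<in> L \<and> I p l \<and> I q l"
  shows "(\<Sum>l\<in>L. of_bool (I p l) * (\<Sum>q\<in>P. of_bool (I q l) * x q)) = (real D - 1) * x p + (\<Sum>q\<in>P. x q)"
proof -
  have "(\<Sum>l\<in>L. of_bool (I p l) * (\<Sum>q\<in>P. of_bool (I q l) * x q))
      = (\<Sum>q\<in>P. \<Sum>l\<in>L. of_bool (I p l \<and> I q l) * x q)"
    unfolding sum_distrib_left by (subst sum.swap) (simp add: of_bool_conj mult.assoc)
  also have "\<dots> = (\<Sum>q\<in>P. real (card {l \<in> L. I p l \<and> I q l}) * x q)"
    using fin by (simp add: sum_distrib_right[symmetric] Int_def)
  also have "\<dots> = (\<Sum>q\<in>P. x q + (if q = p then (real D - 1) * x p else 0))"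
  proof (rule sum.cong[OF refl])
    fix q assume q: "q \<in> P"
    show "real (card {l \<in> L. I p l \<and> I q l}) * x q = x q + (if q = p then (real D - 1) * x p else 0)"
    proof (cases "q = p")
      case True
      then show ?thesis using deg by (simp add: algebra_simps)
    next
      case False
      then obtain k where "{l \<in> L. I p l \<and> I q l} = {k}" using join[OF q] by blast
      then show ?thesis using False by simp
    qed
  qed
  also have "\<dots> = (real D - 1) * x p + (\<Sum>q\<in>P. x q)"
    using fin p by (simp add: sum.distrib)
  finally show ?thesis .
qed

text \<open>For an eigenvector \<open>x\<close> whose eigenvalue realizes the HL-index, A^2 acts on
  each class as D - 1 plus the class sum. If both class sums vanish, the square of the eigenvalue is
  D - 1; otherwise it would be D^2.\<close>

lemma plane_HL_index:
  assumes simple: "simple_graph n E" and bip: "bipartite_graph n E" and n: "0 < n"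
    and D3: "3 \<le> max_degree n E"
    and PP: "is_PP_incidence_graph n E (max_degree n E - 1)"
  shows "HL_index n E = sqrt (real (max_degree n E) - 1)"
proof -
  define D where "D = max_degree n E"
  have sym: "E u v = E v u" if "u < n" "v < n" for u v
    using simple that by (simp add: simple_graph_def)
  obtain P L where PL: "P \<union> L = {0..<n}" "P \<inter> L = {}"
    and cross: "\<forall>u<n. \<forall>v<n. E u v \<longrightarrow> (u \<in> P \<and> v \<in> L) \<or> (u \<in> L \<and> v \<in> P)"
    and plane: "projective_plane_of_order P L E (D - 1)"
    using PP unfolding is_PP_incidence_graph_def D_def by blast
  have part: "bipartition n E P L"
    using PL cross unfolding bipartition_def by (auto simp: atLeast0LessThan)
  then have part': "bipartition n E L P" by (rule bipartition_sym)
  have fin: "finite P" "finite L" using PL(1) by (metis finite_Un finite_atLeastLessThan)+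
  have lt: "p \<in> P \<Longrightarrow> p < n" "l \<in> L \<Longrightarrow> l < n" for p l using PL(1) by auto
  have deg: "card {l \<in> L. E p l} = D" if "p \<in> P" for p
  proof (rule antisym)
    show "card {l \<in> L. E p l} \<le> D"
      using degree_le_max[of p n E] lt that bipartition_neighbours[OF part that]
      by (simp add: degree_def D_def)
    show "D \<le> card {l \<in> L. E p l}"
      using plane_degree[OF plane that fin(2)] D3 by (simp add: D_def)
  qed
  have size: "card {p \<in> P. E p l} = D" if "l \<in> L" for l
    using plane that D3 unfolding projective_plane_of_order_def D_def by auto
  have join: "\<exists>!l. l \<in> L \<and> E a l \<and> E b l" if "a \<in> P" "b \<in> P" "a \<noteq> b" for a b
    using plane that unfolding projective_plane_of_order_def by blast
  have meet: "\<exists>!p. p \<in> P \<and> E p l \<and> E p j" if "l \<in> L" "j \<in> L" "l \<noteq> j" for l j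
    using plane that unfolding projective_plane_of_order_def by blast
  obtain \<mu> where \<mu>: "eigenvalue (adj_matrix n E) \<mu>" "HL_index n E = \<bar>\<mu>\<bar>"
    using HL_index_eigenvalue(1)[OF simple bip n] by blast
  have adj: "adj_matrix n E = mat n n (\<lambda>(i, j). of_bool (E i j))"
    by (rule eq_matI) (auto simp: adj_matrix_def)
  obtain x where x: "\<exists>i<n. x i \<noteq> 0" "\<And>i. i < n \<Longrightarrow> (\<Sum>j<n. of_bool (E i j) * x j) = \<mu> * x i"
    using \<mu>(1) unfolding adj eigenvalue_sum_iff by blast
  have half: "(\<Sum>j<n. of_bool (E i j) * x j) = (\<Sum>l\<in>L. of_bool (E i l) * x l)"
    if "i \<in> P" "bipartition n E P L" for i P L
    using that by (intro sum.mono_neutral_right) (auto simp: bipartition_def)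
  have xP: "(\<Sum>l\<in>L. of_bool (E p l) * x l) = \<mu> * x p" if "p \<in> P" for p
    using half[OF that part] x(2)[of p] lt that by simp
  have xL: "(\<Sum>p\<in>P. of_bool (E p l) * x p) = \<mu> * x l" if "l \<in> L" for l
  proof -
    have "(\<Sum>p\<in>P. of_bool (E p l) * x p) = (\<Sum>p\<in>P. of_bool (E l p) * x p)"
      using lt that sym by (intro sum.cong) auto
    then show ?thesis using half[OF that part'] x(2)[of l] lt that by simp
  qed
  have AP: "\<mu>\<^sup>2 * x p = (real D - 1) * x p + (\<Sum>q\<in>P. x q)" if p: "p \<in> P" for p
  proof -
    have "(\<Sum>l\<in>L. of_bool (E p l) * (\<Sum>q\<in>P. of_bool (E q l) * x q)) = (\<Sum>l\<in>L. \<mu> * (of_bool (E p l) * x l))"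
      using xL by (intro sum.cong) auto
    also have "\<dots> = \<mu>\<^sup>2 * x p"
      using xP[OF p] by (simp add: sum_distrib_left[symmetric] power2_eq_square)
    finally show ?thesis using join_operator[of P L p E D x, OF fin p deg[OF p] join[OF p]] by simp
  qed
  have AL: "\<mu>\<^sup>2 * x l = (real D - 1) * x l + (\<Sum>j\<in>L. x j)" if l: "l \<in> L" for l
  proof -
    have "(\<Sum>p\<in>P. of_bool (E p l) * (\<Sum>j\<in>L. of_bool (E p j) * x j)) = (\<Sum>p\<in>P. \<mu> * (of_bool (E p l) * x p))"
      using xP by (intro sum.cong) auto
    also have "\<dots> = \<mu>\<^sup>2 * x l"
      using xL[OF l] by (simp add: sum_distrib_left[symmetric] power2_eq_square)
    finally show ?thesis
      using join_operator[of L P l "\<lambda>l p. E p l" D x, OF fin(2,1) l size[OF l] meet[OF l]] by simp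
  qed
  \<comment> \<open>Summing the eigenvalue equation over one class counts every vertex of the other
    \<open>D\<close> times.\<close>
  define sP sL where "sP = (\<Sum>q\<in>P. x q)" and "sL = (\<Sum>l\<in>L. x l)"
  have "\<mu> * sP = (\<Sum>l\<in>L. \<Sum>p\<in>P. of_bool (E p l) * x l)"
    unfolding sP_def sum_distrib_left by (subst sum.swap) (simp add: xP)
  also have "\<dots> = real D * sL"
    using fin size unfolding sL_def sum_distrib_left
    by (intro sum.cong) (auto simp: sum_distrib_right[symmetric] Int_def)
  finally have 1: "\<mu> * sP = real D * sL" .
  have "\<mu> * sL = (\<Sum>p\<in>P. \<Sum>l\<in>L. of_bool (E p l) * x p)"
    unfolding sL_def sum_distrib_left by (subst sum.swap) (simp add: xL)
  also have "\<dots> = real D * sP"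
    using fin deg unfolding sP_def sum_distrib_left
    by (intro sum.cong) (auto simp: sum_distrib_right[symmetric] Int_def)
  finally have 2: "\<mu> * sL = real D * sP" .
  have "\<mu>\<^sup>2 = real D - 1"
  proof (cases "sP = 0 \<and> sL = 0")
    case True
    obtain i where i: "i < n" "x i \<noteq> 0" using x(1) by blast
    then have "i \<in> P \<union> L" unfolding PL(1) by simp
    then have "i \<in> P \<or> i \<in> L" by simp
    then have "\<mu>\<^sup>2 * x i = (real D - 1) * x i"
    proof
      assume "i \<in> P"
      have "\<mu>\<^sup>2 * x i = (real D - 1) * x i + 0" using AP[OF \<open>i \<in> P\<close>] True sP_def by metis
      then show ?thesis by (simp only: add_0_right)
    next
      assume "i \<in> L"
      have "\<mu>\<^sup>2 * x i = (real D - 1) * x i + 0" using AL[OF \<open>i \<in> L\<close>] True sL_def by metis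
      then show ?thesis by (simp only: add_0_right)
    qed
    then show ?thesis using i by simp
  next
    case False
    have "\<mu> * (\<mu> * sP) = real D * (real D * sP)" "\<mu> * (\<mu> * sL) = real D * (real D * sL)"
      unfolding 1 2 by (simp_all only: mult.left_commute[of \<mu>] 1 2)
    then have "\<mu>\<^sup>2 = (real D)\<^sup>2" using False by (auto simp: power2_eq_square)
    then have "sqrt (\<mu>\<^sup>2) = sqrt ((real D)\<^sup>2)" by (rule arg_cong)
    then have HD: "HL_index n E = real D" using \<mu>(2) by simp
    have Dpos: "1 < real D" using D3 by (simp add: D_def)
    \<comment> \<open>If all eigenvalues had absolute value at least \<open>D\<close>, the
      coercivity constant \<open>m\<close> could be taken above \<open>D\<close>. The unit vector at
      vertex 0 refutes this, as its image has squared norm \<open>degree n E 0\<close>.\<close>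
    have "sqrt (real D) < real D" using Dpos by (intro real_less_lsqrt) (auto simp: power2_eq_square)
    then obtain m where m: "(sqrt (real D))\<^sup>2 < m" "\<And>x :: nat \<Rightarrow> real.
      m * (\<Sum>i<n. (x i)\<^sup>2) \<le> (\<Sum>i<n. (\<Sum>j<n. of_bool (i < n \<and> j < n \<and> E i j) * x j)\<^sup>2)"
      using adj_matrix_coercive[OF simple bip n, of "sqrt (real D)"] HD by auto
    define y where "y = (\<lambda>i. if i = (0::nat) then 1 else 0 :: real)"
    have "(\<Sum>i<n. (y i)\<^sup>2) = 1"
      using n by (simp add: y_def if_distrib[of "\<lambda>a. a\<^sup>2"] cong: if_cong)
    moreover have "(\<Sum>j<n. of_bool (i < n \<and> j < n \<and> E i j) * y j) = of_bool (i < n \<and> E i 0)" for i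
      using n by (simp add: y_def if_distrib[of "\<lambda>a. _ * a"] cong: if_cong)
    moreover have "(\<Sum>i<n. (of_bool (i < n \<and> E i 0))\<^sup>2) = real (degree n E 0)"
    proof -
      have "{i \<in> {..<n}. E i 0} = {v. v < n \<and> E 0 v}" using sym n by auto
      moreover have "(\<Sum>i<n. (of_bool (i < n \<and> E i 0))\<^sup>2) = (\<Sum>i<n. if E i 0 then 1 else 0 :: real)"
        by (intro sum.cong) auto
      ultimately show ?thesis by (simp add: degree_def sum.If_cases Int_def)
    qed
    ultimately have "m \<le> real (degree n E 0)" using m(2)[of y] by (simp only: mult_1_right)
    also have "\<dots> \<le> real D" using degree_le_max[OF n] by (simp add: D_def)
    finally show ?thesis using m(1) by simp
  qed
  then have "sqrt (\<mu>\<^sup>2) = sqrt (real D - 1)" by (rule arg_cong)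
  then show ?thesis using \<mu>(2) by (simp add: D_def)
qed

theorem theorem2p4:
  fixes n :: nat and E :: "nat \<Rightarrow> nat \<Rightarrow> bool"
  assumes "simple_graph n E" and "connected_graph n E" and "bipartite_graph n E"
    and "max_degree n E \<ge> 3"
  shows "(\<not> is_PP_incidence_graph n E (max_degree n E - 1) \<longrightarrow>
            HL_index n E \<le> sqrt (real (max_degree n E) - 2)) \<and>
         (is_PP_incidence_graph n E (max_degree n E - 1) \<longrightarrow>
            HL_index n E = sqrt (real (max_degree n E) - 1))"
  using large_HL_imp_plane[OF assms] plane_HL_index[OF assms(1,3) _ assms(4)] assms(2)
  by (auto simp: connected_graph_def not_less[symmetric])

end
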